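(* Let $F$ be an algebraically closed field of characteristic not equal to $2$ and $R=F[[x,y]]/(x^2)$. None of the $R$-modules $\widetilde R$, $Q$ and $G$ is isomorphic to a direct summand of a direct product of finitely generated Cohen--Macaulay $R$-modules.
   Context: An $R$-module $N$ is called Cohen--Macaulay (CM) if $\mathrm{Hom}_R(F,N)=0$, where $F=R/(x,y)$; equivalently, $ny=0$ with $n\in N$ implies $n=0$. $Q=R[y^{-1}]$ is the total quotient ring of $R$; $\widetilde R=R+xQ$ is the integral closure of $R$ in $Q$; $G=F((y))$ is the Laurent series field viewed as an $R$-module with $x$ acting as zero. *)

theory Defs
  imports
    "HOL-Algebra.Algebra"
    "HOL-Algebra.Algebraic_Closure_Type"
    "HOL-Computational_Algebra.Computational_Algebra"
begin

section \<open>Modules over a commutative ring\<close>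

definition restrict_scalars :: "('a \<Rightarrow> 'b) \<Rightarrow> ('b, 'm) ring_scheme \<Rightarrow> ('a, 'b) module" where
  "restrict_scalars h S =
     \<lparr>carrier = carrier S, monoid.mult = monoid.mult S, one = one S,
      ring.zero = ring.zero S, add = add S, module.smult = (\<lambda>r s. h r \<otimes>\<^bsub>S\<^esub> s)\<rparr>"

text \<open>The ring components \<open>mult\<close> and \<open>one\<close> are part of the module record but play
  no role in the locale \<^locale>\<open>module\<close>; below they are just taken componentwise.\<close>

definition product_module :: "'i set \<Rightarrow> ('i \<Rightarrow> ('a, 'b) module) \<Rightarrow> ('a, 'i \<Rightarrow> 'b) module" where
  "product_module I M =
     \<lparr>carrier = (\<Pi>\<^sub>E i\<in>I. carrier (M i)),
      monoid.mult = (\<lambda>f g. \<lambda>i\<in>I. f i \<otimes>\<^bsub>M i\<^esub> g i),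
      one = (\<lambda>i\<in>I. \<one>\<^bsub>M i\<^esub>),
      ring.zero = (\<lambda>i\<in>I. \<zero>\<^bsub>M i\<^esub>),
      add = (\<lambda>f g. \<lambda>i\<in>I. f i \<oplus>\<^bsub>M i\<^esub> g i),
      module.smult = (\<lambda>r f. \<lambda>i\<in>I. r \<odot>\<^bsub>M i\<^esub> f i)\<rparr>"

definition module_hom_set ::
    "('a, 'm) ring_scheme \<Rightarrow> ('a, 'b, 'n) module_scheme \<Rightarrow> ('a, 'c, 'k) module_scheme \<Rightarrow> ('b \<Rightarrow> 'c) set" where
  "module_hom_set R M N =
     {h \<in> carrier M \<rightarrow> carrier N.
        (\<forall>u\<in>carrier M. \<forall>v\<in>carrier M. h (u \<oplus>\<^bsub>M\<^esub> v) = h u \<oplus>\<^bsub>N\<^esub> h v) \<and>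
        (\<forall>r\<in>carrier R. \<forall>u\<in>carrier M. h (r \<odot>\<^bsub>M\<^esub> u) = r \<odot>\<^bsub>N\<^esub> h u)}"

definition module_isomorphic ::
    "('a, 'm) ring_scheme \<Rightarrow> ('a, 'b, 'n) module_scheme \<Rightarrow> ('a, 'c, 'k) module_scheme \<Rightarrow> bool" where
  "module_isomorphic R M N \<longleftrightarrow> (\<exists>h\<in>module_hom_set R M N. bij_betw h (carrier M) (carrier N))"

definition direct_summand ::
    "'b set \<Rightarrow> ('a, 'm) ring_scheme \<Rightarrow> ('a, 'b, 'n) module_scheme \<Rightarrow> bool" where
  "direct_summand A R M \<longleftrightarrow>
     submodule A R M \<and>
     (\<exists>B. submodule B R M \<and> A \<inter> B = {\<zero>\<^bsub>M\<^esub>} \<and> A <+>\<^bsub>M\<^esub> B = carrier M)"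

definition iso_to_direct_summand ::
    "('a, 'm) ring_scheme \<Rightarrow> ('a, 'b, 'n) module_scheme \<Rightarrow> ('a, 'c, 'k) module_scheme \<Rightarrow> bool" where
  "iso_to_direct_summand R N M \<longleftrightarrow>
     (\<exists>A. direct_summand A R M \<and> module_isomorphic R N (M\<lparr>carrier := A\<rparr>))"

definition finitely_generated_module ::
    "('a, 'm) ring_scheme \<Rightarrow> ('a, 'b, 'n) module_scheme \<Rightarrow> bool" where
  "finitely_generated_module R M \<longleftrightarrow>
     (\<exists>A \<subseteq> carrier M. finite A \<and>
        (\<forall>u\<in>carrier M. \<exists>c\<in>A \<rightarrow> carrier R. u = (\<Oplus>\<^bsub>M\<^esub>a\<in>A. c a \<odot>\<^bsub>M\<^esub> a)))"

lemma (in ring_hom_cring) restrict_scalars_module: "module R (restrict_scalars h S)"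
proof -
  have "abelian_group (restrict_scalars h S)"
    by (rule abelian_groupI)
       (auto simp: restrict_scalars_def S.a_assoc S.a_comm S.a_lcomm intro: S.add.l_inv_ex)
  then show ?thesis
    by (auto intro!: moduleI R.is_cring
        simp: restrict_scalars_def S.l_distr S.r_distr S.m_assoc)
qed

lemma product_module_module:
  assumes R: "cring R" and M: "\<And>i. i \<in> I \<Longrightarrow> module R (M i)"
  shows "module R (product_module I M)"
proof (rule moduleI[OF R])
  have ag: "abelian_group (M i)" if "i \<in> I" for i
    using M[OF that] by (simp add: module_def)
  note am = abelian_group.axioms(1)[OF ag]
  show "abelian_group (product_module I M)"
  proof (rule abelian_groupI)
    fix f assume f: "f \<in> carrier (product_module I M)"
    show "\<exists>g\<in>carrier (product_module I M).
        g \<oplus>\<^bsub>product_module I M\<^esub> f = \<zero>\<^bsub>product_module I M\<^esub>"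
      using f by (intro bexI[of _ "\<lambda>i\<in>I. \<ominus>\<^bsub>M i\<^esub> f i"])
        (auto simp: product_module_def restrict_def fun_eq_iff PiE_def Pi_def
           extensional_def abelian_group.l_neg[OF ag] abelian_group.a_inv_closed[OF ag])
  qed (auto simp: product_module_def restrict_def fun_eq_iff PiE_def Pi_def extensional_def
        abelian_monoid.a_closed[OF am] abelian_monoid.a_assoc[OF am]
        abelian_monoid.zero_closed[OF am] abelian_monoid.l_zero[OF am]
        intro!: abelian_monoid.a_comm[OF am])
qed (auto simp: product_module_def restrict_def fun_eq_iff PiE_def Pi_def extensional_def
       module.smult_l_distr[OF M] module.smult_r_distr[OF M] module.smult_assoc1[OF M]
       module.smult_one[OF M] module.smult_closed[OF M]
       abelian_monoid.a_closed[OF abelian_group.axioms(1)[OF module.axioms(2)[OF M]]])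


section \<open>Total quotient ring and integral closure\<close>

definition regular_elements :: "('a, 'm) ring_scheme \<Rightarrow> 'a set" where
  "regular_elements R =
     {s \<in> carrier R. \<forall>a\<in>carrier R. a \<otimes>\<^bsub>R\<^esub> s = \<zero>\<^bsub>R\<^esub> \<longrightarrow> a = \<zero>\<^bsub>R\<^esub>}"

definition tq_frac :: "('a, 'm) ring_scheme \<Rightarrow> 'a \<Rightarrow> 'a \<Rightarrow> ('a \<times> 'a) set" where
  "tq_frac R a s =
     {(b, t). b \<in> carrier R \<and> t \<in> regular_elements R \<and> a \<otimes>\<^bsub>R\<^esub> t = b \<otimes>\<^bsub>R\<^esub> s}"

text \<open>Fractions are equivalence classes of pairs; the unions below are the usual way of
  lifting an operation that is compatible with the equivalence, see
  \<open>tq_add\<close> and \<open>tq_mult\<close>.\<close>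

definition total_quotient_ring :: "('a, 'm) ring_scheme \<Rightarrow> ('a \<times> 'a) set ring" where
  "total_quotient_ring R =
     \<lparr>carrier = {tq_frac R a s |a s. a \<in> carrier R \<and> s \<in> regular_elements R},
      monoid.mult = (\<lambda>U V. \<Union>(a, s)\<in>U. \<Union>(b, t)\<in>V. tq_frac R (a \<otimes>\<^bsub>R\<^esub> b) (s \<otimes>\<^bsub>R\<^esub> t)),
      one = tq_frac R \<one>\<^bsub>R\<^esub> \<one>\<^bsub>R\<^esub>,
      ring.zero = tq_frac R \<zero>\<^bsub>R\<^esub> \<one>\<^bsub>R\<^esub>,
      add = (\<lambda>U V. \<Union>(a, s)\<in>U. \<Union>(b, t)\<in>V.
               tq_frac R (a \<otimes>\<^bsub>R\<^esub> t \<oplus>\<^bsub>R\<^esub> b \<otimes>\<^bsub>R\<^esub> s) (s \<otimes>\<^bsub>R\<^esub> t))\<rparr>"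

definition tq_embed :: "('a, 'm) ring_scheme \<Rightarrow> 'a \<Rightarrow> ('a \<times> 'a) set" where
  "tq_embed R a = tq_frac R a \<one>\<^bsub>R\<^esub>"

text \<open>The elements of \<open>S\<close> that satisfy a monic polynomial
  \<open>z\<^sup>n + h (c (n-1)) z\<^sup>n\<^sup>-\<^sup>1 + \<dots> + h (c 0) = 0\<close> with coefficients in the image of \<open>h : R \<rightarrow> S\<close>.\<close>

definition integral_closure_in ::
    "('a, 'm) ring_scheme \<Rightarrow> ('b, 'n) ring_scheme \<Rightarrow> ('a \<Rightarrow> 'b) \<Rightarrow> 'b set" where
  "integral_closure_in R S h =
     {z \<in> carrier S. \<exists>n::nat. \<exists>c. (\<forall>i<n. c i \<in> carrier R) \<and>
        z [^]\<^bsub>S\<^esub> n \<oplus>\<^bsub>S\<^esub> (\<Oplus>\<^bsub>S\<^esub>i\<in>{..<n}. h (c i) \<otimes>\<^bsub>S\<^esub> z [^]\<^bsub>S\<^esub> i) = \<zero>\<^bsub>S\<^esub>}"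

lemma UN_pair_const:
  assumes "(a0, s0) \<in> A" "(b0, t0) \<in> B"
    and "\<And>a s b t. (a, s) \<in> A \<Longrightarrow> (b, t) \<in> B \<Longrightarrow> F a s b t = C"
  shows "(\<Union>(a, s)\<in>A. \<Union>(b, t)\<in>B. F a s b t) = C"
proof (intro equalityI subsetI)
  fix z assume "z \<in> C"
  then have "z \<in> F a0 s0 b0 t0" using assms by simp
  with assms(1,2) show "z \<in> (\<Union>(a, s)\<in>A. \<Union>(b, t)\<in>B. F a s b t)" by blast
qed (use assms(3) in auto)

context cring
begin

lemma regular_closed: "s \<in> regular_elements R \<Longrightarrow> s \<in> carrier R"
  by (simp add: regular_elements_def)

lemma regular_cancel:
  assumes "s \<in> regular_elements R" "a \<in> carrier R" "b \<in> carrier R" "a \<otimes> s = b \<otimes> s"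
  shows "a = b"
proof -
  have "(a \<ominus> b) \<otimes> s = \<zero>"
    using assms by (simp add: regular_closed minus_eq l_distr l_minus r_neg)
  moreover have "a \<ominus> b \<in> carrier R" using assms(2,3) by simp
  ultimately have "a \<ominus> b = \<zero>"
    using assms(1) unfolding regular_elements_def by blast
  with assms(2,3) show ?thesis by (simp only: r_right_minus_eq)
qed

lemma regular_one [simp]: "\<one> \<in> regular_elements R"
  by (simp add: regular_elements_def)

lemma regular_mult [simp]:
  assumes "s \<in> regular_elements R" "t \<in> regular_elements R"
  shows "s \<otimes> t \<in> regular_elements R"
proof -
  have c: "s \<in> carrier R" "t \<in> carrier R"
    using assms by (simp_all add: regular_closed)
  have "a = \<zero>" if a: "a \<in> carrier R" "a \<otimes> (s \<otimes> t) = \<zero>" for a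
  proof -
    have "(a \<otimes> s) \<otimes> t = \<zero>" using a c by (simp add: m_assoc)
    then have "a \<otimes> s = \<zero>" using assms(2) a(1) c unfolding regular_elements_def by blast
    then show ?thesis using assms(1) a(1) unfolding regular_elements_def by blast
  qed
  then show ?thesis using c unfolding regular_elements_def by blast
qed

declare regular_closed [simp]

lemma tq_frac_eq_iff:
  assumes "a \<in> carrier R" "b \<in> carrier R" "s \<in> regular_elements R" "t \<in> regular_elements R"
  shows "tq_frac R a s = tq_frac R b t \<longleftrightarrow> a \<otimes> t = b \<otimes> s"
proof
  assume "tq_frac R a s = tq_frac R b t"
  moreover have "(b, t) \<in> tq_frac R b t" using assms by (simp add: tq_frac_def)
  ultimately have "(b, t) \<in> tq_frac R a s" by simp
  then show "a \<otimes> t = b \<otimes> s" by (simp add: tq_frac_def)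
next
  have main: "tq_frac R a s \<subseteq> tq_frac R b t"
    if "a \<in> carrier R" "b \<in> carrier R" "s \<in> regular_elements R" "t \<in> regular_elements R"
      "a \<otimes> t = b \<otimes> s" for a b s t
  proof (clarsimp simp: tq_frac_def)
    fix c u assume cu: "c \<in> carrier R" "u \<in> regular_elements R" "a \<otimes> u = c \<otimes> s"
    have "(b \<otimes> u) \<otimes> s = (b \<otimes> s) \<otimes> u"
      using that cu by (simp add: m_ac)
    also have "\<dots> = (a \<otimes> u) \<otimes> t"
      using that(1-4) cu(1,2) by (simp add: that(5)[symmetric] m_ac)
    also have "\<dots> = (c \<otimes> t) \<otimes> s"
      unfolding cu(3) using that(1-4) cu(1,2) by (simp add: m_ac)
    finally show "b \<otimes> u = c \<otimes> t"
      by (rule regular_cancel[rotated 3]) (simp_all add: that(1-4) cu(1,2))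
  qed
  assume e: "a \<otimes> t = b \<otimes> s"
  show "tq_frac R a s = tq_frac R b t"
    by (rule equalityI[OF main[OF assms e] main[OF assms(2,1,4,3) e[symmetric]]])
qed

lemma tq_mult:
  assumes "a \<in> carrier R" "b \<in> carrier R" "s \<in> regular_elements R" "t \<in> regular_elements R"
  shows "tq_frac R a s \<otimes>\<^bsub>total_quotient_ring R\<^esub> tq_frac R b t = tq_frac R (a \<otimes> b) (s \<otimes> t)"
proof -
  have eq: "tq_frac R (a' \<otimes> b') (s' \<otimes> t') = tq_frac R (a \<otimes> b) (s \<otimes> t)"
    if "(a', s') \<in> tq_frac R a s" "(b', t') \<in> tq_frac R b t" for a' s' b' t'
  proof -
    have c: "a' \<in> carrier R" "b' \<in> carrier R" "s' \<in> regular_elements R" "t' \<in> regular_elements R"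
      and e: "a \<otimes> s' = a' \<otimes> s" "b \<otimes> t' = b' \<otimes> t"
      using that by (auto simp: tq_frac_def)
    have "(a' \<otimes> b') \<otimes> (s \<otimes> t) = (a' \<otimes> s) \<otimes> (b' \<otimes> t)"
      using assms c by (simp add: m_ac)
    also have "\<dots> = (a \<otimes> b) \<otimes> (s' \<otimes> t')"
      unfolding e[symmetric] using assms c by (simp add: m_ac)
    finally show ?thesis using assms c by (subst tq_frac_eq_iff) auto
  qed
  have "(a, s) \<in> tq_frac R a s" "(b, t) \<in> tq_frac R b t"
    using assms by (auto simp: tq_frac_def)
  then have "(\<Union>(a', s')\<in>tq_frac R a s. \<Union>(b', t')\<in>tq_frac R b t. tq_frac R (a' \<otimes> b') (s' \<otimes> t')) = tq_frac R (a \<otimes> b) (s \<otimes> t)"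
    by (rule UN_pair_const) (rule eq)
  then show ?thesis
    by (simp only: total_quotient_ring_def monoid.simps ring.simps)
qed

lemma tq_add:
  assumes "a \<in> carrier R" "b \<in> carrier R" "s \<in> regular_elements R" "t \<in> regular_elements R"
  shows "tq_frac R a s \<oplus>\<^bsub>total_quotient_ring R\<^esub> tq_frac R b t =
         tq_frac R (a \<otimes> t \<oplus> b \<otimes> s) (s \<otimes> t)"
proof -
  have eq: "tq_frac R (a' \<otimes> t' \<oplus> b' \<otimes> s') (s' \<otimes> t') = tq_frac R (a \<otimes> t \<oplus> b \<otimes> s) (s \<otimes> t)"
    if "(a', s') \<in> tq_frac R a s" "(b', t') \<in> tq_frac R b t" for a' s' b' t'
  proof -
    have c: "a' \<in> carrier R" "b' \<in> carrier R" "s' \<in> regular_elements R" "t' \<in> regular_elements R"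
      and e: "a \<otimes> s' = a' \<otimes> s" "b \<otimes> t' = b' \<otimes> t"
      using that by (auto simp: tq_frac_def)
    have "(a' \<otimes> t' \<oplus> b' \<otimes> s') \<otimes> (s \<otimes> t) =
          (a' \<otimes> s) \<otimes> (t' \<otimes> t) \<oplus> (b' \<otimes> t) \<otimes> (s' \<otimes> s)"
      using assms c by (simp add: l_distr r_distr m_ac)
    also have "\<dots> = (a \<otimes> t \<oplus> b \<otimes> s) \<otimes> (s' \<otimes> t')"
      unfolding e[symmetric] using assms c by (simp add: l_distr r_distr m_ac)
    finally show ?thesis using assms c by (subst tq_frac_eq_iff) auto
  qed
  have "(a, s) \<in> tq_frac R a s" "(b, t) \<in> tq_frac R b t"
    using assms by (auto simp: tq_frac_def)
  then have "(\<Union>(a', s')\<in>tq_frac R a s. \<Union>(b', t')\<in>tq_frac R b t. tq_frac R (a' \<otimes> t' \<oplus> b' \<otimes> s') (s' \<otimes> t')) = tq_frac R (a \<otimes> t \<oplus> b \<otimes> s) (s \<otimes> t)"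
    by (rule UN_pair_const) (rule eq)
  then show ?thesis
    by (simp only: total_quotient_ring_def monoid.simps ring.simps)
qed

lemma tq_cases:
  assumes "U \<in> carrier (total_quotient_ring R)"
  obtains a s where "a \<in> carrier R" "s \<in> regular_elements R" "U = tq_frac R a s"
  using assms by (auto simp: total_quotient_ring_def)

lemma tq_closed [simp]:
  "a \<in> carrier R \<Longrightarrow> s \<in> regular_elements R \<Longrightarrow> tq_frac R a s \<in> carrier (total_quotient_ring R)"
  by (auto simp: total_quotient_ring_def)

lemma tq_zero: "\<zero>\<^bsub>total_quotient_ring R\<^esub> = tq_frac R \<zero> \<one>"
  and tq_one: "\<one>\<^bsub>total_quotient_ring R\<^esub> = tq_frac R \<one> \<one>"
  by (simp_all add: total_quotient_ring_def)

lemma total_quotient_ring_cring: "cring (total_quotient_ring R)"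
proof (rule cringI)
  show "abelian_group (total_quotient_ring R)"
  proof (rule abelian_groupI)
    fix U assume "U \<in> carrier (total_quotient_ring R)"
    then obtain a s where "a \<in> carrier R" "s \<in> regular_elements R" "U = tq_frac R a s"
      by (rule tq_cases)
    then show "\<exists>V\<in>carrier (total_quotient_ring R).
        V \<oplus>\<^bsub>total_quotient_ring R\<^esub> U = \<zero>\<^bsub>total_quotient_ring R\<^esub>"
      by (intro bexI[of _ "tq_frac R (\<ominus> a) s"])
         (auto simp: tq_add tq_zero tq_frac_eq_iff l_minus l_neg)
  qed (auto elim!: tq_cases
        simp: tq_add tq_zero tq_frac_eq_iff l_distr r_distr m_ac a_ac)
  show "comm_monoid (total_quotient_ring R)"
    by (rule comm_monoidI) (auto elim!: tq_cases simp: tq_mult tq_one tq_frac_eq_iff m_ac)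
next
  fix U V W
  assume "U \<in> carrier (total_quotient_ring R)" "V \<in> carrier (total_quotient_ring R)"
    "W \<in> carrier (total_quotient_ring R)"
  then show "(U \<oplus>\<^bsub>total_quotient_ring R\<^esub> V) \<otimes>\<^bsub>total_quotient_ring R\<^esub> W =
      U \<otimes>\<^bsub>total_quotient_ring R\<^esub> W \<oplus>\<^bsub>total_quotient_ring R\<^esub> V \<otimes>\<^bsub>total_quotient_ring R\<^esub> W"
    by (elim tq_cases) (simp add: tq_add tq_mult tq_frac_eq_iff l_distr r_distr m_ac)
qed

lemma tq_embed_hom: "ring_hom_cring R (total_quotient_ring R) (tq_embed R)"
  by (intro ring_hom_cring.intro ring_hom_cring_axioms.intro total_quotient_ring_cring is_cring ring_hom_memI)
     (auto simp: tq_embed_def tq_add tq_mult tq_one tq_frac_eq_iff)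

end


section \<open>The ring \<open>F[[x,y]]/(x\<^sup>2)\<close> and the modules \<open>Q\<close>, \<open>G\<close> and the integral closure\<close>

text \<open>\<open>F[[x,y]]\<close> is represented as \<open>F[[y]][[x]]\<close>, i.e.\ by the type \<open>'a fps fps\<close>: the outer
  variable is \<open>x\<close> and the inner one is \<open>y\<close>.\<close>

definition dl_class :: "'a::field fps fps \<Rightarrow> 'a fps fps set" where
  "dl_class p = PIdl\<^bsub>ring_of_type_algebra\<^esub> (fps_X ^ 2) +>\<^bsub>ring_of_type_algebra\<^esub> p"

definition double_line :: "'a::field fps fps set ring" where
  "double_line = ring_of_type_algebra Quot (PIdl\<^bsub>ring_of_type_algebra\<^esub> (fps_X ^ 2))"

definition dl_x :: "'a::field fps fps set" where
  "dl_x = dl_class fps_X"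

definition dl_y :: "'a::field fps fps set" where
  "dl_y = dl_class (fps_const fps_X)"

definition dl_F :: "('a::field fps fps set, 'a fps fps set set) module" where
  "dl_F = restrict_scalars (\<lambda>r. Idl\<^bsub>double_line\<^esub> {dl_x, dl_y} +>\<^bsub>double_line\<^esub> r)
            (double_line Quot (Idl\<^bsub>double_line\<^esub> {dl_x, dl_y}))"

text \<open>\<open>Hom\<^sub>R(F, N) = 0\<close>; by \<open>cohen_macaulay_iff\<close> below this says that \<open>y\<close> acts injectively on \<open>N\<close>.\<close>

definition cohen_macaulay :: "('a::field fps fps set, 'b, 'm) module_scheme \<Rightarrow> bool" where
  "cohen_macaulay N \<longleftrightarrow>
     (\<forall>h\<in>module_hom_set double_line dl_F N. \<forall>u\<in>carrier dl_F. h u = \<zero>\<^bsub>N\<^esub>)"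

text \<open>\<open>dl_Q_carrier\<close> and \<open>dl_integral_closure\<close> below show that these are \<open>R[y\<^sup>-\<^sup>1]\<close>
  and \<open>R + xQ\<close>.\<close>

definition dl_Q :: "('a::field fps fps set, ('a fps fps set \<times> 'a fps fps set) set) module" where
  "dl_Q = restrict_scalars (tq_embed double_line) (total_quotient_ring double_line)"

definition dl_Rtilde :: "('a::field fps fps set, ('a fps fps set \<times> 'a fps fps set) set) module" where
  "dl_Rtilde = dl_Q\<lparr>carrier :=
     integral_closure_in double_line (total_quotient_ring double_line) (tq_embed double_line)\<rparr>"

text \<open>The map \<open>R \<rightarrow> R/(x) = F[[y]] \<rightarrow> F((y))\<close>: all representatives of a class have the same
  constant coefficient with respect to the outer variable \<open>x\<close>.\<close>

definition dl_to_laurent :: "'a::field fps fps set \<Rightarrow> 'a fls" where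
  "dl_to_laurent r = the_elem ((\<lambda>p. fps_to_fls (p $ 0)) ` r)"

definition dl_G :: "('a::field fps fps set, 'a fls) module" where
  "dl_G = restrict_scalars dl_to_laurent ring_of_type_algebra"


subsection \<open>Adequacy of the definitions\<close>

lemma dl_ideal: "ideal (PIdl\<^bsub>ring_of_type_algebra\<^esub> (fps_X ^ 2)) (ring_of_type_algebra :: 'a::field fps fps ring)"
  by (intro cring.cgenideal_ideal cring_from_type_algebra) (simp add: ring_of_type_algebra_def)

lemma double_line_cring: "cring (double_line :: 'a::field fps fps set ring)"
  unfolding double_line_def
  by (intro ideal.quotient_is_cring dl_ideal cring_from_type_algebra)

lemma dl_class_alt: "dl_class p = {p + f * fps_X ^ 2 |f. True}"
  by (auto simp: dl_class_def a_r_coset_def r_coset_def cgenideal_def ring_of_type_algebra_def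
      add.commute)

lemma dl_class_eq_iff:
  "dl_class p = dl_class q \<longleftrightarrow> p $ 0 = q $ 0 \<and> p $ 1 = (q :: 'a::field fps fps) $ 1"
proof
  assume "dl_class p = dl_class q"
  moreover have "p \<in> dl_class p" unfolding dl_class_alt by (auto intro!: exI[of _ 0])
  ultimately obtain f where "p = q + f * fps_X ^ 2" unfolding dl_class_alt by auto
  then show "p $ 0 = q $ 0 \<and> p $ 1 = q $ 1" by (simp add: fps_X_power_mult_right_nth)
next
  assume eq: "p $ 0 = q $ 0 \<and> p $ 1 = q $ 1"
  have sub: "dl_class p \<subseteq> dl_class q" if "p $ 0 = q $ 0" "p $ 1 = q $ 1" for p q :: "'a fps fps"
  proof
    fix g assume "g \<in> dl_class p"
    then obtain f where g: "g = p + f * fps_X ^ 2" unfolding dl_class_alt by auto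
    have "p - q = fps_shift 2 (p - q) * fps_X ^ 2"
    proof (rule fps_ext)
      fix n show "(p - q) $ n = (fps_shift 2 (p - q) * fps_X ^ 2) $ n"
      proof (cases "n < 2")
        case True
        then have "n = 0 \<or> n = 1" by auto
        then show ?thesis using that by (auto simp: fps_X_power_mult_right_nth)
      next
        case False
        then obtain m where "n = m + 2" by (metis add.commute le_Suc_ex not_less)
        then show ?thesis by (simp add: fps_X_power_mult_right_nth)
      qed
    qed
    then have "g = q + (f + fps_shift 2 (p - q)) * fps_X ^ 2"
      unfolding g by (simp add: algebra_simps)
    then show "g \<in> dl_class q" unfolding dl_class_alt by blast
  qed
  show "dl_class p = dl_class q" using eq sub[of p q] sub[of q p] by auto
qed

lemma dl_carrier: "carrier double_line = range dl_class"
  by (auto simp: double_line_def FactRing_def A_RCOSETS_def RCOSETS_def dl_class_def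
      a_r_coset_def ring_of_type_algebra_def)

lemma dl_mult: "dl_class p \<otimes>\<^bsub>double_line\<^esub> dl_class q = dl_class (p * q)"
  using ideal.rcoset_mult_add[OF dl_ideal, of p q]
  by (simp add: double_line_def FactRing_def dl_class_def) (simp add: ring_of_type_algebra_def)

lemma dl_add: "dl_class p \<oplus>\<^bsub>double_line\<^esub> dl_class q = dl_class (p + q)"
  using ring_hom_add[OF ideal.rcos_ring_hom[OF dl_ideal], of p q]
  by (simp add: double_line_def dl_class_def) (simp add: ring_of_type_algebra_def)

lemma dl_one: "\<one>\<^bsub>double_line\<^esub> = dl_class 1"
  by (simp add: double_line_def FactRing_def dl_class_def) (simp add: ring_of_type_algebra_def)

lemma dl_zero: "\<zero>\<^bsub>double_line\<^esub> = dl_class 0"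
proof -
  have "dl_class 0 \<oplus>\<^bsub>double_line\<^esub> dl_class 0 = (dl_class 0 :: 'a fps fps set)"
    by (simp add: dl_add)
  moreover have "dl_class 0 \<in> carrier (double_line :: 'a fps fps set ring)"
    by (simp add: dl_carrier)
  ultimately show ?thesis
    using abelian_group.r_neg abelian_monoid.r_zero double_line_cring
    by (metis cring.axioms(1) ring.ring_simprules(2,9,16,18) ring.ring_simprules(8))
qed

lemma dl_to_laurent_class [simp]: "dl_to_laurent (dl_class p) = fps_to_fls (p $ 0)"
proof -
  have "(\<lambda>p. fps_to_fls (p $ 0)) ` dl_class p = {fps_to_fls (p $ 0)}"
    unfolding dl_class_alt by (auto simp: fps_X_power_mult_right_nth)
  then show ?thesis by (simp add: dl_to_laurent_def)
qed

lemma dl_to_laurent_x: "dl_to_laurent dl_x = 0"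
  and dl_to_laurent_y: "dl_to_laurent dl_y = fls_X"
  by (simp_all add: dl_x_def dl_y_def)

lemma dl_to_laurent_hom: "ring_hom_cring double_line ring_of_type_algebra (dl_to_laurent :: _ \<Rightarrow> 'a::field fls)"
  by (intro ring_hom_cring.intro ring_hom_cring_axioms.intro double_line_cring cring_from_type_algebra ring_hom_memI)
     (auto simp: dl_carrier dl_mult dl_add dl_one ring_of_type_algebra_def fls_times_fps_to_fls)

lemma dl_G_module: "module double_line dl_G"
  unfolding dl_G_def by (intro ring_hom_cring.restrict_scalars_module dl_to_laurent_hom)

lemma dl_Q_module: "module double_line dl_Q"
  unfolding dl_Q_def
  by (intro ring_hom_cring.restrict_scalars_module cring.tq_embed_hom double_line_cring)

lemma (in module) hom_residue_zero_iff:
  assumes x: "x \<in> carrier R" and y: "y \<in> carrier R" and xx: "x \<otimes> x = \<zero>"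
  defines "I \<equiv> Idl {x, y}"
  defines "K \<equiv> restrict_scalars (\<lambda>r. I +> r) (R Quot I)"
  shows "(\<forall>h\<in>module_hom_set R K M. \<forall>u\<in>carrier K. h u = \<zero>\<^bsub>M\<^esub>) \<longleftrightarrow>
         (\<forall>n\<in>carrier M. y \<odot>\<^bsub>M\<^esub> n = \<zero>\<^bsub>M\<^esub> \<longrightarrow> n = \<zero>\<^bsub>M\<^esub>)"
proof -
  have I: "ideal I R" and xyI: "x \<in> I" "y \<in> I"
    unfolding I_def using x y genideal_ideal[of "{x, y}"] genideal_self[of "{x, y}"] by auto
  interpret I: ideal I R by (rule I)
  have carr: "carrier K = {I +> r |r. r \<in> carrier R}"
    by (auto simp: K_def restrict_scalars_def FactRing_def A_RCOSETS_def RCOSETS_def a_r_coset_def)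
  have mlt: "a \<odot>\<^bsub>K\<^esub> (I +> r) = I +> (a \<otimes> r)" if "a \<in> carrier R" "r \<in> carrier R" for a r
    using ring_hom_mult[OF I.rcos_ring_hom that] by (simp add: K_def restrict_scalars_def)
  have plus: "(I +> a) \<oplus>\<^bsub>K\<^esub> (I +> r) = I +> (a \<oplus> r)" if "a \<in> carrier R" "r \<in> carrier R" for a r
    using ring_hom_add[OF I.rcos_ring_hom that] by (simp add: K_def restrict_scalars_def)
  show ?thesis
  proof (intro iffI ballI impI)
    fix h u
    assume tf: "\<forall>n\<in>carrier M. y \<odot>\<^bsub>M\<^esub> n = \<zero>\<^bsub>M\<^esub> \<longrightarrow> n = \<zero>\<^bsub>M\<^esub>"
      and h: "h \<in> module_hom_set R K M" and u: "u \<in> carrier K"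
    obtain r where r: "r \<in> carrier R" "u = I +> r" using u carr by auto
    have hu: "h u \<in> carrier M" using h u by (auto simp: module_hom_set_def)
    have "y \<otimes> r \<in> I" using xyI r by (simp add: I.I_r_closed)
    then have "I +> (y \<otimes> r) = I +> (\<zero> \<otimes> r)"
      using r by (simp add: I.a_rcos_const)
    then have "y \<odot>\<^bsub>K\<^esub> u = \<zero> \<odot>\<^bsub>K\<^esub> u"
      using r y by (simp add: mlt)
    moreover have "h (y \<odot>\<^bsub>K\<^esub> u) = y \<odot>\<^bsub>M\<^esub> h u" "h (\<zero> \<odot>\<^bsub>K\<^esub> u) = \<zero> \<odot>\<^bsub>M\<^esub> h u"
      using h u y by (auto simp: module_hom_set_def)
    ultimately have "y \<odot>\<^bsub>M\<^esub> h u = \<zero>\<^bsub>M\<^esub>" using hu by simp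
    then show "h u = \<zero>\<^bsub>M\<^esub>" using tf hu by blast
  next
    fix n
    assume Z: "\<forall>h\<in>module_hom_set R K M. \<forall>u\<in>carrier K. h u = \<zero>\<^bsub>M\<^esub>"
      and n: "n \<in> carrier M" and yn: "y \<odot>\<^bsub>M\<^esub> n = \<zero>\<^bsub>M\<^esub>"
    have main: "m = \<zero>\<^bsub>M\<^esub>"
      if m: "m \<in> carrier M" "x \<odot>\<^bsub>M\<^esub> m = \<zero>\<^bsub>M\<^esub>" "y \<odot>\<^bsub>M\<^esub> m = \<zero>\<^bsub>M\<^esub>" for m
    proof -
      define J where "J = {r \<in> carrier R. r \<odot>\<^bsub>M\<^esub> m = \<zero>\<^bsub>M\<^esub>}"
      have "ideal J R"
      proof (rule idealI[OF R.ring_axioms])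
        show "subgroup J (add_monoid R)"
          by (rule group.subgroupI[OF R.a_group])
             (use m in \<open>auto simp: J_def smult_l_distr smult_l_minus a_inv_def[symmetric]\<close>)
        fix a b assume "a \<in> J" "b \<in> carrier R"
        then show "b \<otimes> a \<in> J" using m by (auto simp: J_def smult_assoc1)
        then show "a \<otimes> b \<in> J" using \<open>a \<in> J\<close> \<open>b \<in> carrier R\<close> by (simp add: J_def R.m_comm)
      qed
      then have IJ: "I \<subseteq> J"
        unfolding I_def by (rule genideal_minimal) (use m x y in \<open>auto simp: J_def\<close>)
      define h where "h u = the_elem ((\<lambda>r. r \<odot>\<^bsub>M\<^esub> m) ` u)" for u
      have h: "h (I +> r) = r \<odot>\<^bsub>M\<^esub> m" if r: "r \<in> carrier R" for r
      proof -
        have "(\<lambda>r. r \<odot>\<^bsub>M\<^esub> m) ` (I +> r) = {r \<odot>\<^bsub>M\<^esub> m}"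
        proof (intro equalityI subsetI)
          fix z assume "z \<in> (\<lambda>r. r \<odot>\<^bsub>M\<^esub> m) ` (I +> r)"
          then obtain i where i: "i \<in> I" "z = (i \<oplus> r) \<odot>\<^bsub>M\<^esub> m"
            by (auto simp: a_r_coset_def r_coset_def)
          have "i \<in> J" using i IJ by auto
          then have "z = r \<odot>\<^bsub>M\<^esub> m" using i r m by (simp add: J_def smult_l_distr)
          then show "z \<in> {r \<odot>\<^bsub>M\<^esub> m}" by simp
        next
          fix z assume "z \<in> {r \<odot>\<^bsub>M\<^esub> m}"
          then show "z \<in> (\<lambda>r. r \<odot>\<^bsub>M\<^esub> m) ` (I +> r)"
            using I.a_rcos_self[OF r] by auto
        qed
        then show ?thesis by (simp add: h_def)
      qed
      have "h \<in> module_hom_set R K M"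
        by (auto simp: module_hom_set_def carr mlt plus h m smult_l_distr smult_assoc1)
      moreover have "I +> \<one> \<in> carrier K" unfolding carr by auto
      ultimately have "h (I +> \<one>) = \<zero>\<^bsub>M\<^esub>" using Z by blast
      then show ?thesis using m by (simp add: h)
    qed
    have "x \<odot>\<^bsub>M\<^esub> (x \<odot>\<^bsub>M\<^esub> n) = \<zero>\<^bsub>M\<^esub>"
      using x n xx by (simp add: smult_assoc1[symmetric])
    moreover have "y \<odot>\<^bsub>M\<^esub> (x \<odot>\<^bsub>M\<^esub> n) = x \<odot>\<^bsub>M\<^esub> (y \<odot>\<^bsub>M\<^esub> n)"
      using x y n by (simp add: smult_assoc1[symmetric] R.m_comm)
    ultimately have "x \<odot>\<^bsub>M\<^esub> n = \<zero>\<^bsub>M\<^esub>"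
      using main[of "x \<odot>\<^bsub>M\<^esub> n"] x n yn by simp
    then show "n = \<zero>\<^bsub>M\<^esub>" using main[of n] n yn by simp
  qed
qed

lemma dl_x_closed: "dl_x \<in> carrier double_line" and dl_y_closed: "dl_y \<in> carrier double_line"
  by (auto simp: dl_x_def dl_y_def dl_carrier)

lemma dl_x_square: "dl_x \<otimes>\<^bsub>double_line\<^esub> dl_x = \<zero>\<^bsub>double_line\<^esub>"
  by (simp add: dl_x_def dl_mult dl_zero dl_class_eq_iff fps_mult_nth_1)

lemma cohen_macaulay_iff:
  assumes "module double_line N"
  shows "cohen_macaulay N \<longleftrightarrow>
         (\<forall>n\<in>carrier N. dl_y \<odot>\<^bsub>N\<^esub> n = \<zero>\<^bsub>N\<^esub> \<longrightarrow> n = \<zero>\<^bsub>N\<^esub>)"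
  unfolding cohen_macaulay_def dl_F_def
  by (rule module.hom_residue_zero_iff[OF assms dl_x_closed dl_y_closed dl_x_square])

lemma dl_regular_iff: "dl_class p \<in> regular_elements double_line \<longleftrightarrow> p $ 0 \<noteq> 0"
proof
  assume reg: "dl_class p \<in> regular_elements double_line"
  show "p $ 0 \<noteq> 0"
  proof
    assume "p $ 0 = 0"
    then have "dl_x \<otimes>\<^bsub>double_line\<^esub> dl_class p = \<zero>\<^bsub>double_line\<^esub>"
      by (simp add: dl_x_def dl_mult dl_zero dl_class_eq_iff fps_mult_nth_1)
    then have "dl_x = (\<zero>\<^bsub>double_line\<^esub> :: 'a fps fps set)"
      using reg dl_x_closed unfolding regular_elements_def by blast
    then show False by (simp add: dl_x_def dl_zero dl_class_eq_iff)
  qed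
next
  assume "p $ 0 \<noteq> 0"
  then show "dl_class p \<in> regular_elements double_line"
    by (auto simp: regular_elements_def dl_carrier dl_mult dl_zero dl_class_eq_iff fps_mult_nth_1)
qed

lemma dl_power: "dl_class p [^]\<^bsub>double_line\<^esub> (n::nat) = dl_class (p ^ n)"
  by (induction n) (simp_all add: nat_pow_def dl_one dl_mult mult.commute)

lemma dl_Q_carrier:
  "carrier (dl_Q :: ('a::field fps fps set, _) module) =
     {tq_frac double_line a (dl_y [^]\<^bsub>double_line\<^esub> n) |a n::nat. a \<in> carrier double_line}"
proof -
  interpret cring "double_line :: 'a fps fps set ring" by (rule double_line_cring)
  have ypow: "dl_y [^]\<^bsub>double_line\<^esub> n \<in> regular_elements (double_line :: 'a fps fps set ring)" for n :: nat
    by (simp add: dl_y_def dl_power dl_regular_iff)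
  have "\<exists>b n::nat. tq_frac double_line a s = tq_frac double_line b (dl_y [^]\<^bsub>double_line\<^esub> n) \<and>
      b \<in> carrier double_line"
    if as: "a \<in> carrier double_line" "s \<in> regular_elements double_line" for a s :: "'a fps fps set"
  proof -
    obtain p where p: "a = dl_class p" using as dl_carrier by auto
    have "s \<in> carrier double_line" using as by simp
    then obtain t where t: "s = dl_class t" using dl_carrier by auto
    have t0: "t $ 0 \<noteq> 0" using as t by (simp add: dl_regular_iff)
    define k where "k = subdegree (t $ 0)"
    define u where "u = fps_shift k (t $ 0)"
    have "u $ 0 \<noteq> 0" using t0 by (simp add: u_def k_def)
    then have u: "inverse u * u = 1" by (rule inverse_mult_eq_1)
    have tu: "t $ 0 = u * fps_X ^ k" unfolding u_def k_def by (rule subdegree_decompose)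
    define b where "b = p * (fps_const (t $ 0) - fps_X * fps_const (t $ 1)) * fps_const (inverse u * inverse u)"
    have "tq_frac double_line a s = tq_frac double_line (dl_class b) (dl_y [^]\<^bsub>double_line\<^esub> (2 * k))"
    proof (subst tq_frac_eq_iff)
      have c0: "fps_X ^ (2 * k) = (t $ 0 * inverse u) * (t $ 0 * inverse u)"
      proof -
        have "t $ 0 * inverse u = fps_X ^ k" using u unfolding tu by (simp add: algebra_simps)
        then show ?thesis by (simp add: power_add[symmetric] mult_2)
      qed
      have "dl_class (p * fps_const (fps_X ^ (2 * k))) = dl_class (b * t)"
        unfolding dl_class_eq_iff c0 by (simp add: b_def fps_mult_nth_1 algebra_simps)
      then show "a \<otimes>\<^bsub>double_line\<^esub> dl_y [^]\<^bsub>double_line\<^esub> (2 * k) = dl_class b \<otimes>\<^bsub>double_line\<^esub> s"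
        by (simp add: p t dl_y_def dl_power dl_mult fps_const_power)
    qed (use as ypow in \<open>auto simp: dl_carrier\<close>)
    then show ?thesis using dl_carrier by blast
  qed
  then show ?thesis
    using ypow by (auto simp: dl_Q_def restrict_scalars_def total_quotient_ring_def) blast+
qed

lemma image_pair_const:
  assumes "\<And>b t. (b, t) \<in> A \<Longrightarrow> F b t = C" "(a, s) \<in> A"
  shows "(\<lambda>(b, t). F b t) ` A = {C}"
proof -
  have "(\<lambda>(b, t). F b t) q = C" if "q \<in> A" for q
    using assms(1) that by (cases q) simp
  with assms(2) show ?thesis by blast
qed

lemma tq_laurent_hom:
  obtains \<psi> where
    "ring_hom_cring (total_quotient_ring double_line) (ring_of_type_algebra :: 'a::field fls ring) \<psi>"
    "\<And>a s. a \<in> carrier double_line \<Longrightarrow> s \<in> regular_elements double_line \<Longrightarrow>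
       \<psi> (tq_frac double_line a s) = dl_to_laurent a / dl_to_laurent s"
    "\<And>s. s \<in> regular_elements double_line \<Longrightarrow> dl_to_laurent s \<noteq> (0 :: 'a fls)"
proof -
  let ?Q = "total_quotient_ring (double_line :: 'a fps fps set ring)"
  interpret cring "double_line :: 'a fps fps set ring" by (rule double_line_cring)
  note hom = ring_hom_cring.homh[OF dl_to_laurent_hom]
  have mlt: "dl_to_laurent (a \<otimes>\<^bsub>double_line\<^esub> b) = dl_to_laurent a * dl_to_laurent b"
    and pls: "dl_to_laurent (a \<oplus>\<^bsub>double_line\<^esub> b) = dl_to_laurent a + dl_to_laurent b"
    if "a \<in> carrier double_line" "b \<in> carrier double_line" for a b :: "'a fps fps set"
    using ring_hom_mult[OF hom that] ring_hom_add[OF hom that]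
    by (simp_all add: ring_of_type_algebra_def)
  have one: "dl_to_laurent (\<one>\<^bsub>double_line\<^esub> :: 'a fps fps set) = 1"
    using ring_hom_one[OF hom] by (simp add: ring_of_type_algebra_def)
  have nz: "dl_to_laurent s \<noteq> 0" if s: "s \<in> regular_elements double_line" for s :: "'a fps fps set"
  proof -
    have "s \<in> carrier double_line" using s by simp
    then obtain p where "s = dl_class p" using dl_carrier by auto
    with s show ?thesis by (simp add: dl_regular_iff)
  qed
  define \<psi> where "\<psi> U = the_elem ((\<lambda>(a, s). dl_to_laurent a / dl_to_laurent s) ` U)"
    for U :: "('a fps fps set \<times> 'a fps fps set) set"
  have \<psi>: "\<psi> (tq_frac double_line a s) = dl_to_laurent a / dl_to_laurent s"
    if as: "a \<in> carrier double_line" "s \<in> regular_elements double_line" for a s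
  proof -
    have "dl_to_laurent b / dl_to_laurent t = dl_to_laurent a / dl_to_laurent s"
      if "(b, t) \<in> tq_frac double_line a s" for b t
    proof -
      have bt: "b \<in> carrier double_line" "t \<in> regular_elements double_line"
        "a \<otimes>\<^bsub>double_line\<^esub> t = b \<otimes>\<^bsub>double_line\<^esub> s"
        using that by (auto simp: tq_frac_def)
      have "dl_to_laurent a * dl_to_laurent t = dl_to_laurent b * dl_to_laurent s"
        using arg_cong[OF bt(3), of dl_to_laurent] as bt(1,2) by (simp add: mlt)
      then show ?thesis using nz[OF as(2)] nz[OF bt(2)] by (simp add: frac_eq_eq)
    qed
    moreover have "(a, s) \<in> tq_frac double_line a s" using as by (simp add: tq_frac_def)
    ultimately have "(\<lambda>(a, s). dl_to_laurent a / dl_to_laurent s) ` tq_frac double_line a s =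
        {dl_to_laurent a / dl_to_laurent s}"
      by (rule image_pair_const)
    then show ?thesis by (simp add: \<psi>_def)
  qed
  have "ring_hom_cring ?Q (ring_of_type_algebra :: 'a fls ring) \<psi>"
  proof (intro ring_hom_cring.intro ring_hom_cring_axioms.intro total_quotient_ring_cring
      cring_from_type_algebra ring_hom_memI)
    fix U V assume "U \<in> carrier ?Q" "V \<in> carrier ?Q"
    then obtain a s b t where as: "a \<in> carrier double_line" "s \<in> regular_elements double_line"
      "U = tq_frac double_line a s" and bt: "b \<in> carrier double_line"
      "t \<in> regular_elements double_line" "V = tq_frac double_line b t"
      by (elim tq_cases) blast
    show "\<psi> (U \<otimes>\<^bsub>?Q\<^esub> V) = \<psi> U \<otimes>\<^bsub>ring_of_type_algebra\<^esub> \<psi> V"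
      using as bt by (simp add: tq_mult \<psi> mlt ring_of_type_algebra_def)
    show "\<psi> (U \<oplus>\<^bsub>?Q\<^esub> V) = \<psi> U \<oplus>\<^bsub>ring_of_type_algebra\<^esub> \<psi> V"
      using as bt nz[of s] nz[of t]
      by (simp add: tq_add \<psi> mlt pls ring_of_type_algebra_def add_frac_eq)
  qed (auto simp: ring_of_type_algebra_def tq_one \<psi> one)
  then show thesis using \<psi> nz by (rule that)
qed

lemma fls_integral_imp_fps:
  fixes w :: "'a::field fls"
  assumes "w ^ n + (\<Sum>i<n. fps_to_fls (c i) * w ^ i) = 0"
  shows "\<exists>f. w = fps_to_fls f"
proof (rule ccontr)
  assume no: "\<not> ?thesis"
  have neg: "fls_subdegree w < 0"
  proof (rule ccontr)
    assume "\<not> fls_subdegree w < 0"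
    then have "w = fps_to_fls (fls_regpart w)" by simp
    with no show False by blast
  qed
  then have w: "w \<noteq> 0" by auto
  define g where "g = fls_regpart (inverse w)"
  have g: "inverse w = fps_to_fls g"
    unfolding g_def using neg w by (simp add: fls_inverse_subdegree)
  have g0: "g $ 0 = 0"
    unfolding g_def using neg w by (simp add: fls_inverse_subdegree)
  have "0 = inverse w ^ n * (w ^ n + (\<Sum>i<n. fps_to_fls (c i) * w ^ i))"
    using assms by simp
  also have "\<dots> = 1 + (\<Sum>i<n. fps_to_fls (c i) * inverse w ^ (n - i))"
  proof -
    have "inverse w ^ n * (fps_to_fls (c i) * w ^ i) = fps_to_fls (c i) * inverse w ^ (n - i)"
      if "i < n" for i
    proof -
      have "inverse w ^ n = inverse w ^ (n - i) * inverse w ^ i"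
        using that by (simp add: power_add[symmetric])
      then show ?thesis using w by (simp add: power_mult_distrib[symmetric])
    qed
    then have "(\<Sum>i<n. inverse w ^ n * (fps_to_fls (c i) * w ^ i)) =
        (\<Sum>i<n. fps_to_fls (c i) * inverse w ^ (n - i))"
      by (intro sum.cong) auto
    moreover have "inverse w ^ n * w ^ n = 1"
      using w by (simp add: power_mult_distrib[symmetric])
    ultimately show ?thesis by (simp only: distrib_left sum_distrib_left)
  qed
  also have "\<dots> = fps_to_fls (1 + (\<Sum>i<n. c i * g ^ (n - i)))"
  proof -
    have "fps_to_fls (sum h {..<k}) = (\<Sum>i<k. fps_to_fls (h i))" for h :: "nat \<Rightarrow> 'a fps" and k
      by (induction k) simp_all
    then show ?thesis by (simp add: g fls_times_fps_to_fls fps_to_fls_power)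
  qed
  finally have "1 + (\<Sum>i<n. c i * g ^ (n - i)) = 0"
    by (metis fps_to_fls_eq_0_iff)
  then have "(1 + (\<Sum>i<n. c i * g ^ (n - i))) $ 0 = 0" by simp
  then show False using g0 by (simp add: fps_sum_nth fps_power_zeroth power_0_left)
qed

lemma dl_integral_closure:
  fixes Q :: "('a::field fps fps set \<times> 'a fps fps set) set ring"
  defines "Q \<equiv> total_quotient_ring double_line"
  defines "\<iota> \<equiv> tq_embed double_line"
  shows "integral_closure_in double_line Q \<iota> =
    {\<iota> r \<oplus>\<^bsub>Q\<^esub> \<iota> dl_x \<otimes>\<^bsub>Q\<^esub> q |r q. r \<in> carrier double_line \<and> q \<in> carrier Q}"
    (is "?C = ?S")
proof (intro equalityI subsetI)
  interpret R: cring "double_line :: 'a fps fps set ring" by (rule double_line_cring)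
  interpret Q: cring Q unfolding Q_def by (rule R.total_quotient_ring_cring)
  interpret \<iota>: ring_hom_cring double_line Q \<iota> unfolding Q_def \<iota>_def by (rule R.tq_embed_hom)
  {
    fix z assume "z \<in> ?S"
    then obtain r q where r: "r \<in> carrier double_line" and q: "q \<in> carrier Q"
      and z: "z = \<iota> r \<oplus>\<^bsub>Q\<^esub> \<iota> dl_x \<otimes>\<^bsub>Q\<^esub> q" by auto
    have xc: "\<iota> dl_x \<in> carrier Q" by (rule \<iota>.hom_closed[OF dl_x_closed])
    define m where "m = \<iota> dl_x \<otimes>\<^bsub>Q\<^esub> q"
    have m: "m \<in> carrier Q" using xc q by (simp add: m_def)
    have "m \<otimes>\<^bsub>Q\<^esub> m = (\<iota> dl_x \<otimes>\<^bsub>Q\<^esub> \<iota> dl_x) \<otimes>\<^bsub>Q\<^esub> (q \<otimes>\<^bsub>Q\<^esub> q)"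
      using xc q by (simp add: m_def Q.m_ac)
    also have "\<iota> dl_x \<otimes>\<^bsub>Q\<^esub> \<iota> dl_x = \<zero>\<^bsub>Q\<^esub>"
      by (simp add: \<iota>.hom_mult[symmetric] dl_x_square dl_x_closed del: \<iota>.hom_mult)
    finally have mm: "m \<otimes>\<^bsub>Q\<^esub> m = \<zero>\<^bsub>Q\<^esub>" using q by simp
    define u where "u = \<iota> r"
    have u: "u \<in> carrier Q" using r by (simp add: u_def)
    have zz: "z = u \<oplus>\<^bsub>Q\<^esub> m" by (simp add: z u_def m_def)
    have zc: "z \<in> carrier Q" using u m by (simp add: zz)
    define c where "c i = (if i = 0 then r \<otimes>\<^bsub>double_line\<^esub> r else \<ominus>\<^bsub>double_line\<^esub> (r \<oplus>\<^bsub>double_line\<^esub> r))" for i :: nat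
    have "z [^]\<^bsub>Q\<^esub> (2::nat) \<oplus>\<^bsub>Q\<^esub> (\<Oplus>\<^bsub>Q\<^esub>i\<in>{..<2}. \<iota> (c i) \<otimes>\<^bsub>Q\<^esub> z [^]\<^bsub>Q\<^esub> i) =
        z \<otimes>\<^bsub>Q\<^esub> z \<oplus>\<^bsub>Q\<^esub> (\<ominus>\<^bsub>Q\<^esub> (u \<oplus>\<^bsub>Q\<^esub> u) \<otimes>\<^bsub>Q\<^esub> z \<oplus>\<^bsub>Q\<^esub> u \<otimes>\<^bsub>Q\<^esub> u)"
      using r zc by (simp add: numeral_2_eq_2 lessThan_Suc c_def u_def)
    also have "\<dots> = m \<otimes>\<^bsub>Q\<^esub> m"
      unfolding zz using u m by algebra
    finally have "z [^]\<^bsub>Q\<^esub> (2::nat) \<oplus>\<^bsub>Q\<^esub> (\<Oplus>\<^bsub>Q\<^esub>i\<in>{..<2}. \<iota> (c i) \<otimes>\<^bsub>Q\<^esub> z [^]\<^bsub>Q\<^esub> i) = \<zero>\<^bsub>Q\<^esub>"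
      by (simp only: mm)
    moreover have "\<forall>i<2. c i \<in> carrier double_line" using r by (simp add: c_def)
    ultimately show "z \<in> ?C"
      using zc unfolding integral_closure_in_def by blast
  }
  {
    fix z assume "z \<in> ?C"
    then obtain n :: nat and c where zc: "z \<in> carrier Q"
      and c: "\<And>i. i < n \<Longrightarrow> c i \<in> carrier double_line"
      and eq: "z [^]\<^bsub>Q\<^esub> n \<oplus>\<^bsub>Q\<^esub> (\<Oplus>\<^bsub>Q\<^esub>i\<in>{..<n}. \<iota> (c i) \<otimes>\<^bsub>Q\<^esub> z [^]\<^bsub>Q\<^esub> i) = \<zero>\<^bsub>Q\<^esub>"
      unfolding integral_closure_in_def by blast
    let ?L = "ring_of_type_algebra :: 'a fls ring"
    obtain \<psi> where hom: "ring_hom_cring Q ?L \<psi>"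
      and \<psi>: "\<And>a s. a \<in> carrier double_line \<Longrightarrow> s \<in> regular_elements double_line \<Longrightarrow>
       \<psi> (tq_frac double_line a s) = dl_to_laurent a / dl_to_laurent s"
      and nz: "\<And>s. s \<in> regular_elements double_line \<Longrightarrow> dl_to_laurent s \<noteq> (0 :: 'a fls)"
      unfolding Q_def using tq_laurent_hom by blast
    interpret \<psi>: ring_hom_cring Q ?L \<psi> by (rule hom)
    have Lpow: "v [^]\<^bsub>?L\<^esub> k = v ^ k" for v and k :: nat
      by (induction k) (simp_all add: nat_pow_def ring_of_type_algebra_def mult.commute)
    have \<psi>pow: "\<psi> (z [^]\<^bsub>Q\<^esub> k) = \<psi> z ^ k" for k :: nat
    proof -
      have "\<psi> (z [^]\<^bsub>Q\<^esub> k) = \<psi> z [^]\<^bsub>?L\<^esub> k"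
        by (induction k) (use zc in simp_all)
      then show ?thesis by (simp add: Lpow)
    qed
    have Lsum: "(\<Oplus>\<^bsub>?L\<^esub>i\<in>A. f i) = sum f A" if "finite A" for f :: "nat \<Rightarrow> 'a fls" and A
      using that
    proof (induction A rule: finite_induct)
      case (insert x A)
      have "(\<Oplus>\<^bsub>?L\<^esub>i\<in>insert x A. f i) = f x \<oplus>\<^bsub>?L\<^esub> (\<Oplus>\<^bsub>?L\<^esub>i\<in>A. f i)"
        using insert.hyps by (intro \<psi>.S.finsum_insert) (auto simp: ring_of_type_algebra_def)
      with insert show ?case by (simp add: ring_of_type_algebra_def)
    qed (simp add: \<psi>.S.finsum_empty, simp add: ring_of_type_algebra_def)
    have cf: "\<exists>f. \<psi> (\<iota> (c i)) = fps_to_fls f" if i: "i < n" for i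
    proof -
      obtain p where p: "c i = dl_class p" using c[OF i] dl_carrier by auto
      have "\<psi> (\<iota> (c i)) = fps_to_fls (p $ 0)"
        using \<psi>[OF c[OF i] R.regular_one] by (simp add: \<iota>_def tq_embed_def p dl_one)
      then show ?thesis by blast
    qed
    then obtain f where f: "\<And>i. i < n \<Longrightarrow> \<psi> (\<iota> (c i)) = fps_to_fls (f i)" by metis
    have cl: "(\<lambda>i. \<iota> (c i) \<otimes>\<^bsub>Q\<^esub> z [^]\<^bsub>Q\<^esub> i) \<in> {..<n} \<rightarrow> carrier Q" using c zc by auto
    have "\<psi> (z [^]\<^bsub>Q\<^esub> n \<oplus>\<^bsub>Q\<^esub> (\<Oplus>\<^bsub>Q\<^esub>i\<in>{..<n}. \<iota> (c i) \<otimes>\<^bsub>Q\<^esub> z [^]\<^bsub>Q\<^esub> i)) =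
        \<psi> (z [^]\<^bsub>Q\<^esub> n) \<oplus>\<^bsub>?L\<^esub> (\<Oplus>\<^bsub>?L\<^esub>i\<in>{..<n}. \<psi> (\<iota> (c i) \<otimes>\<^bsub>Q\<^esub> z [^]\<^bsub>Q\<^esub> i))"
      using zc cl by (simp add: \<psi>.hom_finsum comp_def)
    also have "(\<Oplus>\<^bsub>?L\<^esub>i\<in>{..<n}. \<psi> (\<iota> (c i) \<otimes>\<^bsub>Q\<^esub> z [^]\<^bsub>Q\<^esub> i)) =
        (\<Sum>i<n. fps_to_fls (f i) * \<psi> z ^ i)"
    proof (simp only: Lsum[OF finite_lessThan], rule sum.cong[OF refl])
      fix i assume "i \<in> {..<n}"
      then have i: "i < n" by simp
      have "\<psi> (\<iota> (c i) \<otimes>\<^bsub>Q\<^esub> z [^]\<^bsub>Q\<^esub> i) = \<psi> (\<iota> (c i)) \<otimes>\<^bsub>?L\<^esub> \<psi> (z [^]\<^bsub>Q\<^esub> i)"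
        using c[OF i] zc by (intro \<psi>.hom_mult) auto
      then show "\<psi> (\<iota> (c i) \<otimes>\<^bsub>Q\<^esub> z [^]\<^bsub>Q\<^esub> i) = fps_to_fls (f i) * \<psi> z ^ i"
        by (simp add: f[OF i] \<psi>pow) (simp add: ring_of_type_algebra_def)
    qed
    finally have "\<psi> z ^ n + (\<Sum>i<n. fps_to_fls (f i) * \<psi> z ^ i) = 0"
      unfolding eq \<psi>.hom_zero by (simp add: \<psi>pow) (simp add: ring_of_type_algebra_def)
    then obtain g where g: "\<psi> z = fps_to_fls g" using fls_integral_imp_fps by blast
    obtain a s where as: "a \<in> carrier double_line" "s \<in> regular_elements double_line"
      and z: "z = tq_frac double_line a s"
      using zc unfolding Q_def by (rule R.tq_cases)
    obtain p t where p: "a = dl_class p" and t: "s = dl_class t"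
      using as(1) R.regular_closed[OF as(2)] unfolding dl_carrier by blast
    have "fps_to_fls (p $ 0) = fps_to_fls g * fps_to_fls (t $ 0)"
      using \<psi>[OF as] nz[OF as(2)] g unfolding z p t by (simp add: field_simps)
    then have p0: "p $ 0 = g * t $ 0" by (simp add: fls_times_fps_to_fls[symmetric])
    define r where "r = dl_class (fps_const g)"
    define q where "q = tq_frac double_line (dl_class (fps_const (p $ 1 - g * t $ 1))) s"
    have "z = \<iota> r \<oplus>\<^bsub>Q\<^esub> \<iota> dl_x \<otimes>\<^bsub>Q\<^esub> q"
    proof -
      have cls: "dl_class v \<in> carrier double_line" for v :: "'a fps fps" by (simp add: dl_carrier)
      have s1: "s \<otimes>\<^bsub>double_line\<^esub> \<one>\<^bsub>double_line\<^esub> = s" "\<one>\<^bsub>double_line\<^esub> \<otimes>\<^bsub>double_line\<^esub> s = s"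
        using as(2) by simp_all
      have "\<iota> r \<oplus>\<^bsub>Q\<^esub> \<iota> dl_x \<otimes>\<^bsub>Q\<^esub> q = tq_frac double_line
          (dl_class (fps_const g) \<otimes>\<^bsub>double_line\<^esub> s \<oplus>\<^bsub>double_line\<^esub>
           dl_x \<otimes>\<^bsub>double_line\<^esub> dl_class (fps_const (p $ 1 - g * t $ 1))) s"
        unfolding Q_def \<iota>_def q_def r_def tq_embed_def
        using as(2) cls by (simp add: R.tq_mult R.tq_add dl_x_closed)
      also have "dl_class (fps_const g) \<otimes>\<^bsub>double_line\<^esub> s \<oplus>\<^bsub>double_line\<^esub>
           dl_x \<otimes>\<^bsub>double_line\<^esub> dl_class (fps_const (p $ 1 - g * t $ 1)) = a"
        unfolding p t dl_x_def dl_mult dl_add dl_class_eq_iff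
        by (simp add: p0 fps_mult_nth_1)
      finally show ?thesis unfolding z by simp
    qed
    moreover have "r \<in> carrier double_line" "q \<in> carrier Q"
      using as(2) by (auto simp: r_def q_def Q_def dl_carrier intro!: R.tq_closed)
    ultimately show "z \<in> ?S" by blast
  }
qed

lemma dl_Rtilde_submodule:
  "submodule (carrier dl_Rtilde) double_line (dl_Q :: ('a::field fps fps set, _) module)"
proof -
  let ?Q = "total_quotient_ring (double_line :: 'a fps fps set ring)"
  let ?i = "tq_embed (double_line :: 'a fps fps set ring)"
  interpret R: cring "double_line :: 'a fps fps set ring" by (rule double_line_cring)
  interpret Q: cring ?Q by (rule R.total_quotient_ring_cring)
  interpret i: ring_hom_cring double_line ?Q ?i by (rule R.tq_embed_hom)
  interpret M: module double_line "dl_Q :: ('a fps fps set, _) module" by (rule dl_Q_module)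
  have car: "carrier dl_Rtilde = {?i r \<oplus>\<^bsub>?Q\<^esub> ?i dl_x \<otimes>\<^bsub>?Q\<^esub> q |r q. r \<in> carrier double_line \<and> q \<in> carrier ?Q}"
    by (simp add: dl_Rtilde_def dl_integral_closure)
  have xc: "?i dl_x \<in> carrier ?Q" by (rule i.hom_closed[OF dl_x_closed])
  have ops: "carrier dl_Q = carrier ?Q" "(\<oplus>\<^bsub>dl_Q\<^esub>) = (\<oplus>\<^bsub>?Q\<^esub>)" "\<zero>\<^bsub>dl_Q\<^esub> = \<zero>\<^bsub>?Q\<^esub>"
    "\<And>r u. r \<odot>\<^bsub>dl_Q\<^esub> u = ?i r \<otimes>\<^bsub>?Q\<^esub> u"
    by (simp_all add: dl_Q_def restrict_scalars_def)
  have sm: "r \<odot>\<^bsub>dl_Q\<^esub> u \<in> carrier dl_Rtilde"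
    if r: "r \<in> carrier double_line" and u: "u \<in> carrier dl_Rtilde"
    for r :: "'a fps fps set" and u
  proof -
    obtain s q where s: "s \<in> carrier double_line" "q \<in> carrier ?Q"
      "u = ?i s \<oplus>\<^bsub>?Q\<^esub> ?i dl_x \<otimes>\<^bsub>?Q\<^esub> q" using u car by auto
    have "r \<odot>\<^bsub>dl_Q\<^esub> u = ?i (r \<otimes>\<^bsub>double_line\<^esub> s) \<oplus>\<^bsub>?Q\<^esub> ?i dl_x \<otimes>\<^bsub>?Q\<^esub> (?i r \<otimes>\<^bsub>?Q\<^esub> q)"
      using r s xc by (simp add: ops Q.r_distr Q.m_ac)
    moreover have "?i r \<otimes>\<^bsub>?Q\<^esub> q \<in> carrier ?Q" using r s by simp
    ultimately show ?thesis unfolding car using r s by blast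
  qed
  show ?thesis
  proof (rule M.submoduleI)
    show sub: "carrier dl_Rtilde \<subseteq> carrier (dl_Q :: ('a fps fps set, _) module)"
      using xc by (auto simp: car ops)
    have "\<zero>\<^bsub>?Q\<^esub> = ?i \<zero>\<^bsub>double_line\<^esub> \<oplus>\<^bsub>?Q\<^esub> ?i dl_x \<otimes>\<^bsub>?Q\<^esub> \<zero>\<^bsub>?Q\<^esub>" using xc by simp
    then show "\<zero>\<^bsub>dl_Q\<^esub> \<in> carrier (dl_Rtilde :: ('a fps fps set, _) module)"
      unfolding car ops by blast
    show "u \<oplus>\<^bsub>dl_Q\<^esub> v \<in> carrier dl_Rtilde" if u: "u \<in> carrier dl_Rtilde" and v: "v \<in> carrier dl_Rtilde"
      for u v :: "('a fps fps set \<times> 'a fps fps set) set"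
    proof -
      obtain r q where r: "r \<in> carrier double_line" "q \<in> carrier ?Q"
        "u = ?i r \<oplus>\<^bsub>?Q\<^esub> ?i dl_x \<otimes>\<^bsub>?Q\<^esub> q" using u car by auto
      obtain s w where s: "s \<in> carrier double_line" "w \<in> carrier ?Q"
        "v = ?i s \<oplus>\<^bsub>?Q\<^esub> ?i dl_x \<otimes>\<^bsub>?Q\<^esub> w" using v car by auto
      have "u \<oplus>\<^bsub>dl_Q\<^esub> v = ?i (r \<oplus>\<^bsub>double_line\<^esub> s) \<oplus>\<^bsub>?Q\<^esub> ?i dl_x \<otimes>\<^bsub>?Q\<^esub> (q \<oplus>\<^bsub>?Q\<^esub> w)"
        using r s xc by (simp add: ops Q.r_distr Q.a_ac)
      moreover have "q \<oplus>\<^bsub>?Q\<^esub> w \<in> carrier ?Q" using r s by simp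
      ultimately show ?thesis unfolding car using r s by blast
    qed
    show "\<ominus>\<^bsub>dl_Q\<^esub> u \<in> carrier dl_Rtilde" if u: "u \<in> carrier dl_Rtilde"
      for u :: "('a fps fps set \<times> 'a fps fps set) set"
    proof -
      have "u \<in> carrier dl_Q" using sub u by auto
      then have "\<ominus>\<^bsub>dl_Q\<^esub> u = (\<ominus>\<^bsub>double_line\<^esub> \<one>\<^bsub>double_line\<^esub>) \<odot>\<^bsub>dl_Q\<^esub> u"
        by (simp add: M.smult_l_minus)
      then show ?thesis using sm[OF _ u, of "\<ominus>\<^bsub>double_line\<^esub> \<one>\<^bsub>double_line\<^esub>"] by simp
    qed
  qed (rule sm)
qed

lemma dl_Rtilde_module: "module double_line dl_Rtilde"
proof -
  have "dl_Rtilde = dl_Q\<lparr>carrier := carrier dl_Rtilde\<rparr>" by (simp add: dl_Rtilde_def)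
  then show ?thesis
    using submodule.submodule_is_module[OF dl_Rtilde_submodule dl_Q_module] by metis
qed

end

theory Submission
  imports Defs
begin

text \<open>Each of the three modules contains a nonzero element \<open>u\<close> divisible by every power of \<open>y\<close>:
  \<open>x\<close> in the integral closure and in \<open>Q\<close>, and \<open>1\<close> in \<open>G\<close>. A finitely generated Cohen--Macaulay
  module is finitely generated and torsion-free over \<open>F[[y]]\<close>, since \<open>R\<close> is generated over
  \<open>F[[y]]\<close> by \<open>1\<close> and \<open>x\<close>. A minimal generating set is then a basis, so only \<open>0\<close> is divisible by
  all powers of \<open>y\<close>. Hence every homomorphism into a product of such modules kills \<open>u\<close>.\<close>

section \<open>Torsion-free modules over a ring with a uniformizer\<close>

text \<open>For finite \<open>B\<close> inside the carrier this is the submodule spanned by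
  \<open>B\<close>, with one coefficient function on \<open>B\<close> as in
  \<open>finitely_generated_module\<close>. For infinite \<open>B\<close> the value of
  \<open>finsum\<close> defaults to zero, hence the finiteness assumptions in some of the lemmas
  below.\<close>

definition lin_combs :: "('a, 'm) ring_scheme \<Rightarrow> ('a, 'b, 'n) module_scheme \<Rightarrow> 'b set \<Rightarrow> 'b set" where
  "lin_combs R M B = {\<Oplus>\<^bsub>M\<^esub>a\<in>B. c a \<odot>\<^bsub>M\<^esub> a |c. c \<in> B \<rightarrow> carrier R}"

lemma lin_combsI:
  "c \<in> B \<rightarrow> carrier R \<Longrightarrow> u = (\<Oplus>\<^bsub>M\<^esub>a\<in>B. c a \<odot>\<^bsub>M\<^esub> a) \<Longrightarrow> u \<in> lin_combs R M B"
  unfolding lin_combs_def by blast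

lemma lin_combsE:
  assumes "u \<in> lin_combs R M B"
  obtains c where "c \<in> B \<rightarrow> carrier R" "u = (\<Oplus>\<^bsub>M\<^esub>a\<in>B. c a \<odot>\<^bsub>M\<^esub> a)"
  using assms unfolding lin_combs_def by blast

lemma finitely_generated_module_iff:
  "finitely_generated_module R M \<longleftrightarrow>
     (\<exists>A \<subseteq> carrier M. finite A \<and> carrier M \<subseteq> lin_combs R M A)"
proof -
  have "(\<exists>c\<in>A \<rightarrow> carrier R. u = (\<Oplus>\<^bsub>M\<^esub>a\<in>A. c a \<odot>\<^bsub>M\<^esub> a)) \<longleftrightarrow> u \<in> lin_combs R M A" for u A
    by (auto intro: lin_combsI elim: lin_combsE)
  then show ?thesis unfolding finitely_generated_module_def by (simp add: subset_iff Ball_def)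
qed

section \<open>Closure properties of spans and redundant generators\<close>

context module
begin

lemma comb_fun_closed:
  "B \<subseteq> carrier M \<Longrightarrow> c \<in> B \<rightarrow> carrier R \<Longrightarrow> (\<lambda>a. c a \<odot>\<^bsub>M\<^esub> a) \<in> B \<rightarrow> carrier M"
  by (auto intro!: smult_closed)

lemma comb_add:
  assumes "B \<subseteq> carrier M" "c \<in> B \<rightarrow> carrier R" "d \<in> B \<rightarrow> carrier R"
  shows "(\<Oplus>\<^bsub>M\<^esub>a\<in>B. c a \<odot>\<^bsub>M\<^esub> a) \<oplus>\<^bsub>M\<^esub> (\<Oplus>\<^bsub>M\<^esub>a\<in>B. d a \<odot>\<^bsub>M\<^esub> a) =
    (\<Oplus>\<^bsub>M\<^esub>a\<in>B. (c a \<oplus> d a) \<odot>\<^bsub>M\<^esub> a)"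
proof -
  have "(\<Oplus>\<^bsub>M\<^esub>a\<in>B. (c a \<oplus> d a) \<odot>\<^bsub>M\<^esub> a) = (\<Oplus>\<^bsub>M\<^esub>a\<in>B. c a \<odot>\<^bsub>M\<^esub> a \<oplus>\<^bsub>M\<^esub> d a \<odot>\<^bsub>M\<^esub> a)"
    using assms by (intro M.finsum_cong') (auto intro!: smult_l_distr M.a_closed smult_closed)
  also have "\<dots> = (\<Oplus>\<^bsub>M\<^esub>a\<in>B. c a \<odot>\<^bsub>M\<^esub> a) \<oplus>\<^bsub>M\<^esub> (\<Oplus>\<^bsub>M\<^esub>a\<in>B. d a \<odot>\<^bsub>M\<^esub> a)"
    using assms by (intro M.finsum_addf comb_fun_closed)
  finally show ?thesis ..
qed

lemma comb_smult:
  assumes "finite B" "B \<subseteq> carrier M" "c \<in> B \<rightarrow> carrier R" "r \<in> carrier R"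
  shows "r \<odot>\<^bsub>M\<^esub> (\<Oplus>\<^bsub>M\<^esub>a\<in>B. c a \<odot>\<^bsub>M\<^esub> a) = (\<Oplus>\<^bsub>M\<^esub>a\<in>B. (r \<otimes> c a) \<odot>\<^bsub>M\<^esub> a)"
proof -
  have "r \<odot>\<^bsub>M\<^esub> (\<Oplus>\<^bsub>M\<^esub>a\<in>B. c a \<odot>\<^bsub>M\<^esub> a) = (\<Oplus>\<^bsub>M\<^esub>a\<in>B. r \<odot>\<^bsub>M\<^esub> (c a \<odot>\<^bsub>M\<^esub> a))"
    using assms by (intro finsum_smult_ldistr comb_fun_closed)
  also have "\<dots> = (\<Oplus>\<^bsub>M\<^esub>a\<in>B. (r \<otimes> c a) \<odot>\<^bsub>M\<^esub> a)"
    using assms by (intro M.finsum_cong') (auto intro!: smult_assoc1[symmetric] smult_closed)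
  finally show ?thesis .
qed

lemma lin_combs_subset: "B \<subseteq> carrier M \<Longrightarrow> lin_combs R M B \<subseteq> carrier M"
  unfolding lin_combs_def by (auto intro!: M.finsum_closed smult_closed)

lemma lin_combs_add:
  assumes "B \<subseteq> carrier M" "u \<in> lin_combs R M B" "v \<in> lin_combs R M B"
  shows "u \<oplus>\<^bsub>M\<^esub> v \<in> lin_combs R M B"
proof -
  obtain c where c: "c \<in> B \<rightarrow> carrier R" "u = (\<Oplus>\<^bsub>M\<^esub>a\<in>B. c a \<odot>\<^bsub>M\<^esub> a)"
    using assms(2) by (rule lin_combsE)
  obtain d where d: "d \<in> B \<rightarrow> carrier R" "v = (\<Oplus>\<^bsub>M\<^esub>a\<in>B. d a \<odot>\<^bsub>M\<^esub> a)"
    using assms(3) by (rule lin_combsE)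
  have "(\<lambda>a. c a \<oplus> d a) \<in> B \<rightarrow> carrier R" using c d by auto
  then show ?thesis
    unfolding c(2) d(2) comb_add[OF assms(1) c(1) d(1)] by (rule lin_combsI) (rule refl)
qed

lemma lin_combs_smult:
  assumes "finite B" "B \<subseteq> carrier M" "u \<in> lin_combs R M B" "r \<in> carrier R"
  shows "r \<odot>\<^bsub>M\<^esub> u \<in> lin_combs R M B"
proof -
  obtain c where c: "c \<in> B \<rightarrow> carrier R" "u = (\<Oplus>\<^bsub>M\<^esub>a\<in>B. c a \<odot>\<^bsub>M\<^esub> a)"
    using assms(3) by (blast elim: lin_combsE)
  have "(\<lambda>a. r \<otimes> c a) \<in> B \<rightarrow> carrier R" using c assms(4) by auto
  then show ?thesis
    unfolding c(2) comb_smult[OF assms(1,2) c(1) assms(4)] by (rule lin_combsI) (rule refl)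
qed

lemma lin_combs_zero: "B \<subseteq> carrier M \<Longrightarrow> \<zero>\<^bsub>M\<^esub> \<in> lin_combs R M B"
proof -
  assume B: "B \<subseteq> carrier M"
  have "(\<Oplus>\<^bsub>M\<^esub>a\<in>B. \<zero> \<odot>\<^bsub>M\<^esub> a) = (\<Oplus>\<^bsub>M\<^esub>a\<in>B. \<zero>\<^bsub>M\<^esub>)"
    using B by (intro M.finsum_cong') auto
  then have "\<zero>\<^bsub>M\<^esub> = (\<Oplus>\<^bsub>M\<^esub>a\<in>B. (\<lambda>_. \<zero>) a \<odot>\<^bsub>M\<^esub> a)" by simp
  moreover have "(\<lambda>_. \<zero>) \<in> B \<rightarrow> carrier R" by auto
  ultimately show ?thesis by (intro lin_combsI)
qed

lemma lin_combs_base: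
  assumes "finite B" "B \<subseteq> carrier M" "b \<in> B"
  shows "b \<in> lin_combs R M B"
proof -
  let ?c = "\<lambda>a. if a = b then \<one> else \<zero>"
  \<comment> \<open>The condition is turned round to \<open>b = a\<close> to match the form of
    \<open>finsum_singleton\<close>.\<close>
  have "(\<Oplus>\<^bsub>M\<^esub>a\<in>B. ?c a \<odot>\<^bsub>M\<^esub> a) = (\<Oplus>\<^bsub>M\<^esub>a\<in>B. if b = a then a else \<zero>\<^bsub>M\<^esub>)"
    using assms by (intro M.finsum_cong') auto
  also have "\<dots> = b" using assms by (intro M.finsum_singleton) auto
  finally have "b = (\<Oplus>\<^bsub>M\<^esub>a\<in>B. ?c a \<odot>\<^bsub>M\<^esub> a)" ..
  moreover have "?c \<in> B \<rightarrow> carrier R" by auto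
  ultimately show ?thesis by (intro lin_combsI)
qed

text \<open>This is the substitution principle for changing generating sets: it serves both to drop
  a redundant generator and to pass from generators over R to generators over F[[y]].\<close>

lemma lin_combs_finsum:
  assumes "finite A" "B \<subseteq> carrier M" "\<And>a. a \<in> A \<Longrightarrow> f a \<in> lin_combs R M B"
  shows "(\<Oplus>\<^bsub>M\<^esub>a\<in>A. f a) \<in> lin_combs R M B"
  using assms(1,3)
proof (induction A rule: finite_induct)
  case empty
  then show ?case using lin_combs_zero[OF assms(2)] by simp
next
  case (insert a A)
  have "f \<in> insert a A \<rightarrow> carrier M" using insert.prems lin_combs_subset[OF assms(2)] by auto
  then have "(\<Oplus>\<^bsub>M\<^esub>a\<in>insert a A. f a) = f a \<oplus>\<^bsub>M\<^esub> (\<Oplus>\<^bsub>M\<^esub>a\<in>A. f a)"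
    using insert.hyps by (intro M.finsum_insert) auto
  then show ?case using insert lin_combs_add[OF assms(2)] by auto
qed

text \<open>Dividing the relation by the unit \<open>c b\<close> expresses \<open>b\<close> through
  the remaining generators, and this expression can be substituted into any linear
  combination.\<close>

lemma relation_unit_coeff_imp_redundant:
  assumes B: "finite B" "B \<subseteq> carrier M" "carrier M \<subseteq> lin_combs R M B"
    and c: "c \<in> B \<rightarrow> carrier R" "(\<Oplus>\<^bsub>M\<^esub>a\<in>B. c a \<odot>\<^bsub>M\<^esub> a) = \<zero>\<^bsub>M\<^esub>"
    and b: "b \<in> B" "c b \<in> Units R"
  shows "carrier M \<subseteq> lin_combs R M (B - {b})"
proof -
  let ?D = "B - {b}" and ?s = "\<Oplus>\<^bsub>M\<^esub>a\<in>B - {b}. c a \<odot>\<^bsub>M\<^esub> a"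
  have D: "finite ?D" "?D \<subseteq> carrier M" using B by auto
  have s: "?s \<in> lin_combs R M ?D" using c(1) by (auto intro!: lin_combsI)
  then have sM: "?s \<in> carrier M" using lin_combs_subset[OF D(2)] by blast
  have bM: "b \<in> carrier M" and cb: "c b \<in> carrier R" using B b c by auto
  have cbM: "c b \<odot>\<^bsub>M\<^esub> b \<in> carrier M" using bM cb by simp
  have "(\<Oplus>\<^bsub>M\<^esub>a\<in>insert b ?D. c a \<odot>\<^bsub>M\<^esub> a) = c b \<odot>\<^bsub>M\<^esub> b \<oplus>\<^bsub>M\<^esub> ?s"
    using D cbM c(1) by (intro M.finsum_insert comb_fun_closed) auto
  then have "c b \<odot>\<^bsub>M\<^esub> b \<oplus>\<^bsub>M\<^esub> ?s = \<zero>\<^bsub>M\<^esub>"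
    using c(2) b(1) by (simp add: insert_absorb)
  then have "c b \<odot>\<^bsub>M\<^esub> b = \<ominus>\<^bsub>M\<^esub> ?s"
    using cbM sM by (metis M.minus_equality)
  \<comment> \<open>Negation is written as multiplication by the scalar -1, so that closure under
    scalars applies.\<close>
  then have "c b \<odot>\<^bsub>M\<^esub> b = (\<ominus> \<one>) \<odot>\<^bsub>M\<^esub> ?s"
    using sM by (simp add: smult_l_minus)
  then have "c b \<odot>\<^bsub>M\<^esub> b \<in> lin_combs R M ?D"
    using lin_combs_smult[OF D s] by simp
  then have "inv (c b) \<odot>\<^bsub>M\<^esub> (c b \<odot>\<^bsub>M\<^esub> b) \<in> lin_combs R M ?D"
    using lin_combs_smult[OF D] b(2) by simp
  moreover have "inv (c b) \<odot>\<^bsub>M\<^esub> (c b \<odot>\<^bsub>M\<^esub> b) = b"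
    using b(2) bM cb by (simp add: smult_assoc1[symmetric])
  ultimately have bD: "b \<in> lin_combs R M ?D" by simp
  have base: "a \<in> lin_combs R M ?D" if "a \<in> B" for a
    using bD lin_combs_base[OF D] that by (cases "a = b") auto
  show ?thesis
  proof
    fix u assume "u \<in> carrier M"
    then obtain d where d: "d \<in> B \<rightarrow> carrier R" "u = (\<Oplus>\<^bsub>M\<^esub>a\<in>B. d a \<odot>\<^bsub>M\<^esub> a)"
      using B(3) by (blast elim: lin_combsE)
    show "u \<in> lin_combs R M ?D"
      unfolding d(2) using d(1) by (intro lin_combs_finsum B(1) D(2) lin_combs_smult D base) auto
  qed
qed

text \<open>The assumptions \<open>nonunit\<close> and \<open>sep\<close> are modelled on a discrete
  valuation ring with uniformizer \<open>p\<close>. For a generating set of least cardinality, each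
  coefficient in a relation is divisible by every power of \<open>p\<close>. Comparing expansions of
  \<open>u\<close> and of \<open>v\<close> with \<open>u = p^n v\<close> then makes the coefficients
  of \<open>u\<close> divisible by every \<open>p^n\<close>, so \<open>sep\<close> kills
  them.\<close>

theorem infinitely_divisible_eq_zero:
  assumes fg: "finitely_generated_module R M"
    and p: "p \<in> carrier R"
    and tf: "\<And>u. u \<in> carrier M \<Longrightarrow> p \<odot>\<^bsub>M\<^esub> u = \<zero>\<^bsub>M\<^esub> \<Longrightarrow> u = \<zero>\<^bsub>M\<^esub>"
    and nonunit: "\<And>r. r \<in> carrier R \<Longrightarrow> r \<notin> Units R \<Longrightarrow> \<exists>s\<in>carrier R. r = p \<otimes> s"
    and sep: "\<And>r. r \<in> carrier R \<Longrightarrow> (\<And>n::nat. \<exists>s\<in>carrier R. r = p [^] n \<otimes> s) \<Longrightarrow> r = \<zero>"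
    and u: "u \<in> carrier M"
    and div: "\<And>n::nat. \<exists>v\<in>carrier M. u = p [^] n \<odot>\<^bsub>M\<^esub> v"
  shows "u = \<zero>\<^bsub>M\<^esub>"
proof -
  define gen where "gen B \<longleftrightarrow> finite B \<and> B \<subseteq> carrier M \<and> carrier M \<subseteq> lin_combs R M B" for B
  obtain A where "gen A"
    using fg unfolding finitely_generated_module_iff gen_def by blast
  then obtain B where B: "gen B" and min: "\<And>C. gen C \<Longrightarrow> card B \<le> card C"
    using ex_has_least_nat[of gen A card] by blast
  have Bf: "finite B" "B \<subseteq> carrier M" "carrier M \<subseteq> lin_combs R M B"
    using B by (auto simp: gen_def)
  \<comment> \<open>By minimality no relation has a unit coefficient, so every relation can be divided by \<open>p\<close>.\<close>
  have rel: "\<exists>s\<in>carrier R. c b = p [^] n \<otimes> s"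
    if "c \<in> B \<rightarrow> carrier R" "(\<Oplus>\<^bsub>M\<^esub>a\<in>B. c a \<odot>\<^bsub>M\<^esub> a) = \<zero>\<^bsub>M\<^esub>" "b \<in> B" for c b and n :: nat
    using that
  proof (induction n arbitrary: c)
    case 0
    then have "c b \<in> carrier R" by auto
    then show ?case by (intro bexI[of _ "c b"]) auto
  next
    case (Suc n)
    have "c a \<notin> Units R" if a: "a \<in> B" for a
    proof
      assume "c a \<in> Units R"
      then have "gen (B - {a})"
        using relation_unit_coeff_imp_redundant[OF Bf Suc.prems(1,2) a] Bf by (auto simp: gen_def)
      then show False using min card_Diff1_less[OF Bf(1) a] by fastforce
    qed
    then have "\<forall>a\<in>B. \<exists>s\<in>carrier R. c a = p \<otimes> s" using nonunit Suc.prems(1) by auto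
    then obtain d where d: "\<And>a. a \<in> B \<Longrightarrow> d a \<in> carrier R" "\<And>a. a \<in> B \<Longrightarrow> c a = p \<otimes> d a"
      by metis
    have dB: "d \<in> B \<rightarrow> carrier R" using d by auto
    \<comment> \<open>Multiplying the combination with coefficients \<open>d\<close> by
      \<open>p\<close> gives back the given relation. By torsion-freeness \<open>d\<close> is itself
      a relation, to which the induction hypothesis applies; this is why \<open>c\<close> is
      generalized.\<close>
    have "p \<odot>\<^bsub>M\<^esub> (\<Oplus>\<^bsub>M\<^esub>a\<in>B. d a \<odot>\<^bsub>M\<^esub> a) = (\<Oplus>\<^bsub>M\<^esub>a\<in>B. c a \<odot>\<^bsub>M\<^esub> a)"
      unfolding comb_smult[OF Bf(1,2) dB p]
      using Bf d p by (intro M.finsum_cong') (auto intro!: smult_closed)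
    then have "(\<Oplus>\<^bsub>M\<^esub>a\<in>B. d a \<odot>\<^bsub>M\<^esub> a) = \<zero>\<^bsub>M\<^esub>"
      using Suc.prems(2) tf M.finsum_closed[OF comb_fun_closed[OF Bf(2) dB]] by simp
    then obtain s where s: "s \<in> carrier R" "d b = p [^] n \<otimes> s"
      using Suc.IH[OF dB _ Suc.prems(3)] by blast
    then have "c b = p [^] Suc n \<otimes> s"
      using d(2)[OF Suc.prems(3)] p by (simp add: R.m_ac)
    then show ?case using s by blast
  qed
  obtain s where s: "s \<in> B \<rightarrow> carrier R" "u = (\<Oplus>\<^bsub>M\<^esub>a\<in>B. s a \<odot>\<^bsub>M\<^esub> a)"
    using u Bf(3) by (blast elim: lin_combsE)
  have "s b = \<zero>" if b: "b \<in> B" for b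
  proof (rule sep)
    fix n :: nat
    let ?q = "p [^] n"
    have q: "?q \<in> carrier R" using p by simp
    obtain v where v: "v \<in> carrier M" "u = ?q \<odot>\<^bsub>M\<^esub> v" using div by blast
    then obtain t where t: "t \<in> B \<rightarrow> carrier R" "v = (\<Oplus>\<^bsub>M\<^esub>a\<in>B. t a \<odot>\<^bsub>M\<^esub> a)"
      using Bf(3) by (blast elim: lin_combsE)
    have t': "(\<lambda>a. \<ominus> ?q \<otimes> t a) \<in> B \<rightarrow> carrier R" using t q by auto
    \<comment> \<open>Expanding u - p^n v = 0 gives a relation with coefficients \<open>s a\<close>
      minus \<open>?q\<close> times \<open>t a\<close>. By \<open>rel\<close> these are divisible by
      p^n, and therefore so is \<open>s b\<close>.\<close>
    have "\<zero>\<^bsub>M\<^esub> = u \<oplus>\<^bsub>M\<^esub> (\<ominus> ?q) \<odot>\<^bsub>M\<^esub> v"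
      using v q u by (simp add: smult_l_minus M.r_neg)
    also have "\<dots> = (\<Oplus>\<^bsub>M\<^esub>a\<in>B. (s a \<oplus> \<ominus> ?q \<otimes> t a) \<odot>\<^bsub>M\<^esub> a)"
      using comb_add[OF Bf(2) s(1) t'] comb_smult[OF Bf(1,2) t(1), of "\<ominus> ?q"] q s t by simp
    finally obtain r where r: "r \<in> carrier R" "s b \<oplus> \<ominus> ?q \<otimes> t b = ?q \<otimes> r"
      using rel[of "\<lambda>a. s a \<oplus> \<ominus> ?q \<otimes> t a" b n] s(1) t' b by (auto simp: Pi_iff)
    have c: "s b \<in> carrier R" "t b \<in> carrier R" using s t b by auto
    have "s b = (s b \<oplus> \<ominus> ?q \<otimes> t b) \<oplus> ?q \<otimes> t b"
      using c q by (simp add: R.a_assoc R.l_minus R.l_neg)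
    also have "\<dots> = ?q \<otimes> (r \<oplus> t b)" using r c q by (simp add: R.r_distr)
    finally show "\<exists>s'\<in>carrier R. s b = ?q \<otimes> s'" using r c by blast
  qed (use s b in auto)
  then have "u = (\<Oplus>\<^bsub>M\<^esub>a\<in>B. \<zero>\<^bsub>M\<^esub>)"
    unfolding s(2) using Bf(2) by (intro M.finsum_cong') auto
  then show ?thesis by simp
qed

end


section \<open>The subring \<open>F[[y]]\<close> of the double line\<close>

text \<open>A copy of F[[y]] inside R, consisting of the classes of series constant in x. Since the
  operations are those of \<open>double_line\<close>, restricting scalars leaves the module record
  unchanged.\<close>

definition dl_fps_y :: "'a::field fps fps set ring" where
  "dl_fps_y = double_line\<lparr>carrier := range (\<lambda>f. dl_class (fps_const f))\<rparr>"

lemma dl_fps_y_simps [simp]: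
  "carrier dl_fps_y = range (\<lambda>f. dl_class (fps_const f))"
  "(\<otimes>\<^bsub>dl_fps_y\<^esub>) = (\<otimes>\<^bsub>double_line\<^esub>)" "(\<oplus>\<^bsub>dl_fps_y\<^esub>) = (\<oplus>\<^bsub>double_line\<^esub>)"
  "\<one>\<^bsub>dl_fps_y\<^esub> = \<one>\<^bsub>double_line\<^esub>" "\<zero>\<^bsub>dl_fps_y\<^esub> = \<zero>\<^bsub>double_line\<^esub>"
  by (simp_all add: dl_fps_y_def)

lemma dl_fps_y_cring: "cring (dl_fps_y :: 'a::field fps fps set ring)"
proof (rule cringI)
  \<comment> \<open>The simplifier rewrites \<open>fps_const 0\<close> and
    \<open>fps_const 1\<close> to 0 and 1, which hides that their classes lie in the range.\<close>
  have [simp]: "dl_class 0 \<in> range (\<lambda>f. dl_class (fps_const f))"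
    "dl_class 1 \<in> range (\<lambda>f. dl_class (fps_const f))"
    using rangeI[of "\<lambda>f. dl_class (fps_const f)" 0] rangeI[of "\<lambda>f. dl_class (fps_const f)" 1]
    by simp_all
  show "abelian_group (dl_fps_y :: 'a fps fps set ring)"
  proof (rule abelian_groupI)
    fix u :: "'a fps fps set" assume "u \<in> carrier dl_fps_y"
    then obtain f where "u = dl_class (fps_const f)" by auto
    then show "\<exists>v\<in>carrier dl_fps_y. v \<oplus>\<^bsub>dl_fps_y\<^esub> u = \<zero>\<^bsub>dl_fps_y\<^esub>"
      by (intro bexI[of _ "dl_class (fps_const (- f))"]) (auto simp: dl_add dl_zero)
  qed (auto simp: dl_add dl_zero add_ac)
  show "Group.comm_monoid (dl_fps_y :: 'a fps fps set ring)"
    by (rule comm_monoidI) (auto simp: dl_mult dl_one mult_ac)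
qed (auto simp: dl_add dl_mult algebra_simps)

section \<open>Restriction of scalars from R to F[[y]]\<close>

lemma module_over_dl_fps_y:
  fixes M :: "('a::field fps fps set, 'm) module"
  assumes "module double_line M"
  shows "module dl_fps_y M"
proof -
  interpret module double_line M by fact
  have sub: "carrier dl_fps_y \<subseteq> carrier (double_line :: 'a fps fps set ring)"
    by (auto simp: dl_carrier)
  show ?thesis
    by (rule moduleI[OF dl_fps_y_cring M.abelian_group_axioms])
      (use sub in \<open>auto simp: subset_iff smult_l_distr smult_r_distr smult_assoc1\<close>)
qed

text \<open>Every element of R has the form f + g x with f and g in F[[y]], so generators over R
  together with their multiples by x generate over F[[y]].\<close>

lemma finitely_generated_over_dl_fps_y:
  fixes M :: "('a::field fps fps set, 'm) module"
  assumes M: "module double_line M" and fg: "finitely_generated_module double_line M"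
  shows "finitely_generated_module dl_fps_y M"
proof -
  interpret module double_line M by (rule M)
  interpret S: module dl_fps_y M by (rule module_over_dl_fps_y[OF M])
  obtain A where A: "A \<subseteq> carrier M" "finite A" and gen: "carrier M \<subseteq> lin_combs double_line M A"
    using fg unfolding finitely_generated_module_iff by blast
  define B where "B = A \<union> (\<lambda>a. dl_x \<odot>\<^bsub>M\<^esub> a) ` A"
  have B: "finite B" "B \<subseteq> carrier M" using A dl_x_closed by (auto simp: B_def)
  have sc: "r \<odot>\<^bsub>M\<^esub> a \<in> lin_combs dl_fps_y M B"
    if r: "r \<in> carrier double_line" and a: "a \<in> A" for r a
  proof -
    obtain p where p: "r = dl_class p" using r dl_carrier by auto
    let ?f = "dl_class (fps_const (p $ 0))" and ?g = "dl_class (fps_const (p $ 1))"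
    have aM: "a \<in> carrier M" using a A by auto
    have S: "?f \<in> carrier dl_fps_y" "?g \<in> carrier dl_fps_y" by auto
    have cl: "?f \<in> carrier double_line" "?g \<in> carrier double_line" by (auto simp: dl_carrier)
    \<comment> \<open>A class modulo x^2 is determined by its coefficients at x^0 and x^1.\<close>
    have "r = ?f \<oplus>\<^bsub>double_line\<^esub> ?g \<otimes>\<^bsub>double_line\<^esub> dl_x"
      by (simp add: p dl_x_def dl_mult dl_add dl_class_eq_iff)
    then have "r \<odot>\<^bsub>M\<^esub> a = ?f \<odot>\<^bsub>M\<^esub> a \<oplus>\<^bsub>M\<^esub> ?g \<odot>\<^bsub>M\<^esub> (dl_x \<odot>\<^bsub>M\<^esub> a)"
      using cl aM by (simp add: smult_l_distr smult_assoc1 dl_x_closed)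
    moreover have "a \<in> B" "dl_x \<odot>\<^bsub>M\<^esub> a \<in> B" using a by (auto simp: B_def)
    ultimately show ?thesis
      using S.lin_combs_add[OF B(2)] S.lin_combs_smult[OF B] S.lin_combs_base[OF B] S by simp
  qed
  have "carrier M \<subseteq> lin_combs dl_fps_y M B"
  proof
    fix u assume "u \<in> carrier M"
    then obtain c where "c \<in> A \<rightarrow> carrier double_line" "u = (\<Oplus>\<^bsub>M\<^esub>a\<in>A. c a \<odot>\<^bsub>M\<^esub> a)"
      using gen by (blast elim: lin_combsE)
    then show "u \<in> lin_combs dl_fps_y M B"
      using A(2) B(2) sc by (auto intro!: S.lin_combs_finsum)
  qed
  then show ?thesis using B unfolding finitely_generated_module_iff by blast
qed

lemma dl_y_power: "dl_y [^]\<^bsub>double_line\<^esub> (n::nat) = dl_class (fps_const (fps_X ^ n))"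
  by (simp add: dl_y_def dl_power fps_const_power)

lemma dl_fps_y_power: "r [^]\<^bsub>dl_fps_y\<^esub> (n::nat) = r [^]\<^bsub>double_line\<^esub> n"
  by (simp add: nat_pow_def)

text \<open>This is the abstract divisibility theorem for F[[y]] with uniformizer y; the
  Cohen-Macaulay condition supplies torsion-freeness through
  \<open>cohen_macaulay_iff\<close>.\<close>

lemma dl_y_divisible_eq_zero:
  fixes M :: "('a::field fps fps set, 'm) module"
  assumes M: "module double_line M" and fg: "finitely_generated_module double_line M"
    and cm: "cohen_macaulay M" and u: "u \<in> carrier M"
    and div: "\<And>n::nat. \<exists>v\<in>carrier M. u = dl_y [^]\<^bsub>double_line\<^esub> n \<odot>\<^bsub>M\<^esub> v"
  shows "u = \<zero>\<^bsub>M\<^esub>"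
proof (rule module.infinitely_divisible_eq_zero[OF module_over_dl_fps_y[OF M]
      finitely_generated_over_dl_fps_y[OF M fg], of dl_y])
  show "dl_y \<in> carrier dl_fps_y" by (auto simp: dl_y_def)
  show "w = \<zero>\<^bsub>M\<^esub>" if "w \<in> carrier M" "dl_y \<odot>\<^bsub>M\<^esub> w = \<zero>\<^bsub>M\<^esub>" for w
    using cm cohen_macaulay_iff[OF M] that by blast
  show "\<exists>s\<in>carrier dl_fps_y. r = dl_y \<otimes>\<^bsub>dl_fps_y\<^esub> s"
    if r: "r \<in> carrier dl_fps_y" "r \<notin> Units dl_fps_y" for r :: "'a fps fps set"
  proof -
    obtain f where f: "r = dl_class (fps_const f)" using r by auto
    \<comment> \<open>A power series in y with nonzero constant term has an inverse in F[[y]], so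
      \<open>r\<close> would be a unit of \<open>dl_fps_y\<close>.\<close>
    have "f $ 0 = 0"
    proof (rule ccontr)
      assume "f $ 0 \<noteq> 0"
      then have "inverse f * f = 1" by (rule inverse_mult_eq_1)
      then have "dl_class (fps_const (inverse f)) \<otimes>\<^bsub>dl_fps_y\<^esub> r = \<one>\<^bsub>dl_fps_y\<^esub>"
        "r \<otimes>\<^bsub>dl_fps_y\<^esub> dl_class (fps_const (inverse f)) = \<one>\<^bsub>dl_fps_y\<^esub>"
        by (simp_all add: f dl_mult dl_one mult.commute)
      then show False using r unfolding Units_def by auto
    qed
    then have X: "fps_X * fps_shift 1 f = f"
      by (intro fps_ext) (simp add: fps_X_mult_nth)
    have "r = dl_y \<otimes>\<^bsub>dl_fps_y\<^esub> dl_class (fps_const (fps_shift 1 f))"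
      using X by (simp add: f dl_y_def dl_mult)
    then show ?thesis by auto
  qed
  show "r = \<zero>\<^bsub>dl_fps_y\<^esub>"
    if r: "r \<in> carrier dl_fps_y" and
      d: "\<And>n::nat. \<exists>s\<in>carrier dl_fps_y. r = dl_y [^]\<^bsub>dl_fps_y\<^esub> n \<otimes>\<^bsub>dl_fps_y\<^esub> s"
    for r :: "'a fps fps set"
  proof -
    obtain f where f: "r = dl_class (fps_const f)" using r by auto
    have "f $ n = 0" for n
    proof -
      \<comment> \<open>The exponent is \<open>Suc n\<close>, because divisibility by y^(n+1) is
        what forces coefficient \<open>n\<close> to vanish.\<close>
      obtain g where "r = dl_class (fps_const (fps_X ^ Suc n)) \<otimes>\<^bsub>double_line\<^esub> dl_class (fps_const g)"
        using d[of "Suc n"] unfolding dl_fps_y_power dl_y_power by auto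
      then have "f = fps_X ^ Suc n * g" by (simp add: f dl_mult dl_class_eq_iff del: power_Suc)
      then show ?thesis by (simp add: fps_X_power_mult_nth del: power_Suc)
    qed
    then have "f = 0" by (simp add: fps_eq_iff)
    then show ?thesis by (simp add: f dl_zero)
  qed
qed (use u div in \<open>auto simp: dl_fps_y_power\<close>)


section \<open>Elements divisible by all powers of \<open>y\<close>\<close>

text \<open>An isomorphism onto a summand is an injective homomorphism into the product. Followed by
  a projection it preserves divisibility by powers of y, so every component of the image of
  \<open>u\<close> vanishes, contradicting injectivity.\<close>

lemma not_iso_to_direct_summand_product:
  fixes M :: "'i \<Rightarrow> ('a::field fps fps set, 'm) module"
  assumes M: "\<And>i. i \<in> I \<Longrightarrow> module double_line (M i)"
    and fg: "\<And>i. i \<in> I \<Longrightarrow> finitely_generated_module double_line (M i)"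
    and cm: "\<And>i. i \<in> I \<Longrightarrow> cohen_macaulay (M i)"
    and N: "module double_line N"
    and u: "u \<in> carrier N" "u \<noteq> \<zero>\<^bsub>N\<^esub>"
    and div: "\<And>n::nat. \<exists>v\<in>carrier N. u = dl_y [^]\<^bsub>double_line\<^esub> n \<odot>\<^bsub>N\<^esub> v"
  shows "\<not> iso_to_direct_summand double_line N (product_module I M)"
proof
  let ?P = "product_module I M"
  assume "iso_to_direct_summand double_line N ?P"
  then obtain A h where A: "submodule A double_line ?P"
    and h: "h \<in> module_hom_set double_line N (?P\<lparr>carrier := A\<rparr>)" and bij: "bij_betw h (carrier N) A"
    by (auto simp: iso_to_direct_summand_def direct_summand_def module_isomorphic_def)
  interpret N: module double_line N by (rule N)
  interpret P: module double_line ?P by (rule product_module_module[OF double_line_cring M])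
  have AP: "A \<subseteq> carrier ?P"
    using A by (auto simp: submodule_def subgroup_def)
  have hP: "h v \<in> carrier ?P" if "v \<in> carrier N" for v
    using bij AP that by (auto simp: bij_betw_def)
  have hs: "h (r \<odot>\<^bsub>N\<^esub> v) = r \<odot>\<^bsub>?P\<^esub> h v" if "r \<in> carrier double_line" "v \<in> carrier N" for r v
    using h that by (simp add: module_hom_set_def)
  have "h u i = \<zero>\<^bsub>M i\<^esub>" if i: "i \<in> I" for i
  proof (rule dl_y_divisible_eq_zero[OF M[OF i] fg[OF i] cm[OF i]])
    fix n :: nat
    obtain v where v: "v \<in> carrier N" "u = dl_y [^]\<^bsub>double_line\<^esub> n \<odot>\<^bsub>N\<^esub> v" using div by blast
    have "h u = dl_y [^]\<^bsub>double_line\<^esub> n \<odot>\<^bsub>?P\<^esub> h v"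
      using v hs by (simp add: dl_y_closed)
    then have "h u i = dl_y [^]\<^bsub>double_line\<^esub> n \<odot>\<^bsub>M i\<^esub> h v i"
      using i by (simp add: product_module_def)
    moreover have "h v i \<in> carrier (M i)"
      using hP[OF v(1)] i by (auto simp: product_module_def)
    ultimately show "\<exists>v\<in>carrier (M i). h u i = dl_y [^]\<^bsub>double_line\<^esub> n \<odot>\<^bsub>M i\<^esub> v" by blast
  qed (use hP[OF u(1)] i in \<open>auto simp: product_module_def\<close>)
  \<comment> \<open>Elements of the product are extensional functions, so agreement on
    \<open>I\<close> is equality.\<close>
  then have "h u = \<zero>\<^bsub>?P\<^esub>"
    using hP[OF u(1)] by (auto simp: product_module_def PiE_def extensional_def)
  \<comment> \<open>Preservation of zero follows from compatibility with the zero scalar, since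
    \<open>module_hom_set\<close> does not state it separately.\<close>
  also have "\<dots> = h \<zero>\<^bsub>N\<^esub>"
    using hs[of "\<zero>\<^bsub>double_line\<^esub>" "\<zero>\<^bsub>N\<^esub>"] hP by simp
  finally show False
    using bij u by (auto simp: bij_betw_def inj_on_def)
qed

section \<open>Divisible elements in the three modules\<close>

lemma dl_G_divisible:
  "\<exists>v\<in>carrier dl_G. (1 :: 'a::field fls) = dl_y [^]\<^bsub>double_line\<^esub> (n::nat) \<odot>\<^bsub>dl_G\<^esub> v"
  by (intro bexI[of _ "inverse (fls_X ^ n)"])
    (auto simp: dl_G_def restrict_scalars_def ring_of_type_algebra_def dl_y_power fps_to_fls_power)

text \<open>The integral closure is R + xQ and so contains every x/y^n, although it need not contain
  1/y^n. The element is nonzero because R embeds in Q.\<close>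

lemma dl_Rtilde_divisible:
  fixes n :: nat
  defines "x \<equiv> tq_embed (double_line :: 'a::field fps fps set ring) dl_x"
  shows "x \<in> carrier dl_Rtilde" "x \<noteq> \<zero>\<^bsub>dl_Rtilde\<^esub>"
    "\<exists>v\<in>carrier dl_Rtilde. x = dl_y [^]\<^bsub>double_line\<^esub> n \<odot>\<^bsub>dl_Rtilde\<^esub> v"
proof -
  let ?R = "double_line :: 'a fps fps set ring"
  let ?Q = "total_quotient_ring ?R"
  let ?i = "tq_embed ?R"
  interpret R: cring ?R by (rule double_line_cring)
  interpret Q: cring ?Q by (rule R.total_quotient_ring_cring)
  interpret i: ring_hom_cring ?R ?Q ?i by (rule R.tq_embed_hom)
  have car: "carrier dl_Rtilde = {?i r \<oplus>\<^bsub>?Q\<^esub> ?i dl_x \<otimes>\<^bsub>?Q\<^esub> q |r q. r \<in> carrier ?R \<and> q \<in> carrier ?Q}"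
    by (simp add: dl_Rtilde_def dl_integral_closure)
  have xc: "x \<in> carrier ?Q" unfolding x_def by (rule i.hom_closed[OF dl_x_closed])
  have mem: "x \<otimes>\<^bsub>?Q\<^esub> q \<in> carrier dl_Rtilde" if q: "q \<in> carrier ?Q" for q
  proof -
    have "x \<otimes>\<^bsub>?Q\<^esub> q = ?i \<zero>\<^bsub>?R\<^esub> \<oplus>\<^bsub>?Q\<^esub> ?i dl_x \<otimes>\<^bsub>?Q\<^esub> q"
      using xc q by (simp add: x_def)
    then show ?thesis unfolding car using q by blast
  qed
  have "x \<otimes>\<^bsub>?Q\<^esub> \<one>\<^bsub>?Q\<^esub> \<in> carrier dl_Rtilde" by (rule mem) simp
  then show "x \<in> carrier dl_Rtilde" using xc by simp
  have "dl_x \<noteq> \<zero>\<^bsub>?R\<^esub>" by (simp add: dl_x_def dl_zero dl_class_eq_iff)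
  then show "x \<noteq> \<zero>\<^bsub>dl_Rtilde\<^esub>"
    by (simp add: x_def dl_Rtilde_def dl_Q_def restrict_scalars_def R.tq_zero tq_embed_def
        R.tq_frac_eq_iff dl_x_closed)
  \<comment> \<open>This is 1/y^n in Q; the witness for divisibility is x times it, which lies in
    xQ.\<close>
  let ?q = "tq_frac ?R \<one>\<^bsub>?R\<^esub> (dl_y [^]\<^bsub>?R\<^esub> n)"
  have reg: "dl_y [^]\<^bsub>?R\<^esub> n \<in> regular_elements ?R"
    by (simp add: dl_y_power dl_regular_iff)
  have q: "?q \<in> carrier ?Q" using reg by simp
  have "?i (dl_y [^]\<^bsub>?R\<^esub> n) \<otimes>\<^bsub>?Q\<^esub> ?q = \<one>\<^bsub>?Q\<^esub>"
    using reg by (simp add: tq_embed_def R.tq_mult R.tq_one R.tq_frac_eq_iff)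
  then have "x = x \<otimes>\<^bsub>?Q\<^esub> (?i (dl_y [^]\<^bsub>?R\<^esub> n) \<otimes>\<^bsub>?Q\<^esub> ?q)"
    using xc by simp
  also have "\<dots> = ?i (dl_y [^]\<^bsub>?R\<^esub> n) \<otimes>\<^bsub>?Q\<^esub> (x \<otimes>\<^bsub>?Q\<^esub> ?q)"
    using xc q reg by (simp add: Q.m_lcomm del: i.hom_mult)
  finally have "x = dl_y [^]\<^bsub>?R\<^esub> n \<odot>\<^bsub>dl_Rtilde\<^esub> (x \<otimes>\<^bsub>?Q\<^esub> ?q)"
    by (simp add: dl_Rtilde_def dl_Q_def restrict_scalars_def)
  then show "\<exists>v\<in>carrier dl_Rtilde. x = dl_y [^]\<^bsub>?R\<^esub> n \<odot>\<^bsub>dl_Rtilde\<^esub> v"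
    using mem[OF q] by blast
qed

theorem lemma5p12:
  fixes I :: "'i set"
    and M :: "'i \<Rightarrow> ('a::alg_closed_field fps fps set, 'm) module"
  assumes "CHAR('a) \<noteq> 2"
    and "\<And>i. i \<in> I \<Longrightarrow> module double_line (M i)"
    and "\<And>i. i \<in> I \<Longrightarrow> finitely_generated_module double_line (M i)"
    and "\<And>i. i \<in> I \<Longrightarrow> cohen_macaulay (M i)"
  shows "\<not> iso_to_direct_summand double_line dl_Rtilde (product_module I M) \<and>
         \<not> iso_to_direct_summand double_line dl_Q (product_module I M) \<and>
         \<not> iso_to_direct_summand double_line dl_G (product_module I M)"
proof (intro conjI)
  note no = not_iso_to_direct_summand_product[where I = I and M = M, OF assms(2-4)]
  let ?x = "tq_embed (double_line :: 'a fps fps set ring) dl_x"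
  have sub: "carrier dl_Rtilde \<subseteq> carrier (dl_Q :: ('a fps fps set, _) module)"
    using dl_Rtilde_submodule by (auto simp: submodule_def subgroup_def)
  have eq: "\<zero>\<^bsub>dl_Rtilde\<^esub> = \<zero>\<^bsub>dl_Q :: ('a fps fps set, _) module\<^esub>"
    "(\<odot>\<^bsub>dl_Rtilde\<^esub>) = (\<odot>\<^bsub>dl_Q :: ('a fps fps set, _) module\<^esub>)"
    by (simp_all add: dl_Rtilde_def)
  show "\<not> iso_to_direct_summand double_line dl_Rtilde (product_module I M)"
    by (rule no[OF _ _ _ dl_Rtilde_module dl_Rtilde_divisible])
  show "\<not> iso_to_direct_summand double_line dl_Q (product_module I M)"
  \<comment> \<open>The same element x works in Q, which contains the integral closure as a
    submodule with the same operations.\<close>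
  proof (rule no[OF _ _ _ dl_Q_module])
    note div = dl_Rtilde_divisible[where 'a = 'a]
    show "?x \<in> carrier dl_Q" using sub div(1) by blast
    show "?x \<noteq> \<zero>\<^bsub>dl_Q\<^esub>" using div(2) unfolding eq .
    show "\<exists>v\<in>carrier dl_Q. ?x = dl_y [^]\<^bsub>double_line\<^esub> n \<odot>\<^bsub>dl_Q\<^esub> v" for n :: nat
      using sub div(3)[of n] unfolding eq by blast
  qed
  show "\<not> iso_to_direct_summand double_line dl_G (product_module I M)"
    \<comment> \<open>Here \<open>dl_G_divisible\<close> fixes the divisible element as 1, since y
      acts invertibly on F((y)).\<close>
    by (rule no[OF _ _ _ dl_G_module _ _ dl_G_divisible])
      (auto simp: dl_G_def restrict_scalars_def ring_of_type_algebra_def)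
qed

end
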